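(* Let $d\ge3$. There are positive constants $c$ (possibly different at each occurrence) depending only on $d$ such that the following holds. Let $L\ge1$, $N\ge100L$ be integers and let $\phi$ be a function from the collection of subsets of $C(0)=B(0,L)\subseteq E$ to $[0,1]$ which is monotone decreasing, i.e. $\phi(A)\ge\phi(A')$ whenever $A\subseteq A'\subseteq C(0)$. Then for all $u>0$ and $s>0$, $$P\Big[\Gamma_u<E[\Gamma_{c_{11}u}]-c\,e^{-cuL^{d-2}}-s\Big]\le c\,\frac{\sigma^2_{u,L,N}}{s^2}+c\,N^de^{-cuL^{d-2}},$$ $$P\Big[\Gamma_u>E[\Gamma_{c_{11}^{-1}u}]+c\,e^{-cuL^{d-2}}+s\Big]\le c\,\frac{\sigma^2_{u,L,N}}{s^2}+c\,N^de^{-cuL^{d-2}},$$ where $$\sigma^2_{u,L,N}=\inf\Big\{\Big(\frac rN\Big)^d+u\frac{L^d}r:\ r\text{ integer},\ 10L\le r\le\frac N{10}\Big\},$$ and $c_{11}=c_8/c_9>1$ with $c_8,c_9$ as described in the context.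
   Context: $[\cdot]$ denotes integer part. $E=(\mathbb Z/N\mathbb Z)^d$, and $B(x,\rho)$ is the closed ball in $E$ of center $x$, radius $\rho$, for the $\ell^\infty$-distance. $P$ (with expectation $E[\cdot]$) is the law of simple random walk $(X_n)_{n\ge0}$ on $E$ (uniform nearest neighbor steps $\pm e_i$) started from the uniform distribution; $X_{[0,t]}=\{X_n:0\le n\le t\}$. For $x\in E$, $C(x)=B(x,L)$. For $t\ge0$, $h(x,t)=\phi\big((X_{[0,t]}\cap C(x))-x\big)$ and, for $u>0$, $$\Gamma_u=\frac1{N^d}\sum_{x\in E}h(x,uN^d).$$ The constants $c_8>c_9>0$ depend only on $d$ and are fixed such that the following holds (such constants exist): for all integers $L\ge1$, $r\ge10L$, $N\ge10r$, all $x\in E$ and $u>0$, $$P[R^x_{[c_8uL^{d-2}]}\le uN^d]\le c\,e^{-cuL^{d-2}},\qquad P[D^x_{[c_9uL^{d-2}]}\ge uN^d]\le c\,e^{-cuL^{d-2}},$$ with $c$ positive constants depending only on $d$. Here, with $\tilde C(x)=B(x,r)$, $R^x_k,D^x_k$ are the successive returns to $C(x)$ and departures from $\tilde C(x)$: $R^x_0=D^x_0=0$, $R^x_1=\inf\{n\ge0:X_n\in C(x)\}$, $D^x_k=\inf\{n\ge R^x_k:X_n\notin\tilde C(x)\}$, $R^x_{k+1}=\inf\{n\ge D^x_k:X_n\in C(x)\}$, $k\ge1$. *)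

theory Defs
  imports "HOL-Probability.Probability"
begin

section \<open>The discrete torus\<close>

text \<open>
  A residue class modulo N is represented by its representative in {0..<N}; a point of
  the torus of dimension d is a function on the coordinates {..<d}, extensional outside them.
\<close>

definition torus :: "nat \<Rightarrow> nat \<Rightarrow> (nat \<Rightarrow> int) set" where
  "torus d N = {..<d} \<rightarrow>\<^sub>E {0..<int N}"

definition torus_zero :: "nat \<Rightarrow> nat \<Rightarrow> int" where
  "torus_zero d = (\<lambda>i\<in>{..<d}. 0)"

definition torus_add :: "nat \<Rightarrow> nat \<Rightarrow> (nat \<Rightarrow> int) \<Rightarrow> (nat \<Rightarrow> int) \<Rightarrow> nat \<Rightarrow> int" where
  "torus_add d N x y = (\<lambda>i\<in>{..<d}. (x i + y i) mod int N)"

definition torus_diff :: "nat \<Rightarrow> nat \<Rightarrow> (nat \<Rightarrow> int) \<Rightarrow> (nat \<Rightarrow> int) \<Rightarrow> nat \<Rightarrow> int" where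
  "torus_diff d N x y = (\<lambda>i\<in>{..<d}. (x i - y i) mod int N)"

text \<open>The least absolute value of an integer congruent to a - b modulo N.\<close>

definition circle_dist :: "nat \<Rightarrow> int \<Rightarrow> int \<Rightarrow> int" where
  "circle_dist N a b = min ((a - b) mod int N) ((b - a) mod int N)"

definition torus_dist :: "nat \<Rightarrow> nat \<Rightarrow> (nat \<Rightarrow> int) \<Rightarrow> (nat \<Rightarrow> int) \<Rightarrow> int" where
  "torus_dist d N x y = Max ((\<lambda>i. circle_dist N (x i) (y i)) ` {..<d})"

definition torus_ball :: "nat \<Rightarrow> nat \<Rightarrow> (nat \<Rightarrow> int) \<Rightarrow> nat \<Rightarrow> (nat \<Rightarrow> int) set" where
  "torus_ball d N x \<rho> = {y \<in> torus d N. torus_dist d N x y \<le> int \<rho>}"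

section \<open>Simple random walk started from the uniform distribution\<close>

definition unit_steps :: "nat \<Rightarrow> (nat \<Rightarrow> int) set" where
  "unit_steps d = {(\<lambda>i. if i = j then e else 0) | j e. j < d \<and> e \<in> {1, -1}}"

text \<open>A sample point is a starting point together with the independent increments of the walk.\<close>

definition srw_space :: "nat \<Rightarrow> nat \<Rightarrow> ((nat \<Rightarrow> int) \<times> (nat \<Rightarrow> nat \<Rightarrow> int)) measure" where
  "srw_space d N =
     measure_pmf (pmf_of_set (torus d N)) \<Otimes>\<^sub>M
     (\<Pi>\<^sub>M n\<in>(UNIV :: nat set). measure_pmf (pmf_of_set (unit_steps d)))"

primrec walk ::
  "nat \<Rightarrow> nat \<Rightarrow> nat \<Rightarrow> (nat \<Rightarrow> int) \<times> (nat \<Rightarrow> nat \<Rightarrow> int) \<Rightarrow> nat \<Rightarrow> int" where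
  "walk d N 0 \<omega> = fst \<omega>"
| "walk d N (Suc n) \<omega> = torus_add d N (walk d N n \<omega>) (snd \<omega> n)"

definition walk_range ::
  "nat \<Rightarrow> nat \<Rightarrow> real \<Rightarrow> (nat \<Rightarrow> int) \<times> (nat \<Rightarrow> nat \<Rightarrow> int) \<Rightarrow> (nat \<Rightarrow> int) set" where
  "walk_range d N t \<omega> = {walk d N n \<omega> | n. real n \<le> t}"

section \<open>Returns to B(x,L) and departures from B(x,r)\<close>

text \<open>The value is infinity if the set is not visited at or after time m.\<close>

definition hit_from :: "(nat \<Rightarrow> 'a) \<Rightarrow> 'a set \<Rightarrow> enat \<Rightarrow> enat" where
  "hit_from X A m = Inf {enat n | n. m \<le> enat n \<and> X n \<in> A}"

fun return_time :: "(nat \<Rightarrow> 'a) \<Rightarrow> 'a set \<Rightarrow> 'a set \<Rightarrow> nat \<Rightarrow> enat"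
  and departure_time :: "(nat \<Rightarrow> 'a) \<Rightarrow> 'a set \<Rightarrow> 'a set \<Rightarrow> nat \<Rightarrow> enat" where
  "return_time X C C' 0 = 0"
| "return_time X C C' (Suc k) = hit_from X C (departure_time X C C' k)"
| "departure_time X C C' 0 = 0"
| "departure_time X C C' (Suc k) = hit_from X (- C') (return_time X C C' (Suc k))"

abbreviation srw_return where
  "srw_return d N L r x k \<omega> \<equiv>
     return_time (\<lambda>n. walk d N n \<omega>) (torus_ball d N x L) (torus_ball d N x r) k"

abbreviation srw_departure where
  "srw_departure d N L r x k \<omega> \<equiv>
     departure_time (\<lambda>n. walk d N n \<omega>) (torus_ball d N x L) (torus_ball d N x r) k"

text \<open>
  The admissible pairs of constants c8, c9 in dimension d. The unnamed positive constants of the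
  two tail bounds, in the prefactor and in the exponent, may all be different.
\<close>

definition excursion_constants :: "nat \<Rightarrow> real \<Rightarrow> real \<Rightarrow> bool" where
  "excursion_constants d c8 c9 \<longleftrightarrow>
     0 < c9 \<and> c9 < c8 \<and>
     (\<exists>a>0. \<exists>b>0. \<forall>L r N :: nat. \<forall>x\<in>torus d N. \<forall>u::real.
        1 \<le> L \<longrightarrow> 10 * L \<le> r \<longrightarrow> 10 * r \<le> N \<longrightarrow> 0 < u \<longrightarrow>
        \<P>(\<omega> in srw_space d N.
            ereal_of_enat (srw_return d N L r x (nat \<lfloor>c8 * u * real L ^ (d - 2)\<rfloor>) \<omega>)
              \<le> ereal (u * real N ^ d))
        \<le> a * exp (- (b * u * real L ^ (d - 2)))) \<and>
     (\<exists>a>0. \<exists>b>0. \<forall>L r N :: nat. \<forall>x\<in>torus d N. \<forall>u::real.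
        1 \<le> L \<longrightarrow> 10 * L \<le> r \<longrightarrow> 10 * r \<le> N \<longrightarrow> 0 < u \<longrightarrow>
        \<P>(\<omega> in srw_space d N.
            ereal_of_enat (srw_departure d N L r x (nat \<lfloor>c9 * u * real L ^ (d - 2)\<rfloor>) \<omega>)
              \<ge> ereal (u * real N ^ d))
        \<le> a * exp (- (b * u * real L ^ (d - 2))))"

section \<open>Spatial averages of a local functional of the range\<close>

definition local_value ::
  "nat \<Rightarrow> nat \<Rightarrow> nat \<Rightarrow> ((nat \<Rightarrow> int) set \<Rightarrow> real) \<Rightarrow> (nat \<Rightarrow> int) \<Rightarrow> real
   \<Rightarrow> (nat \<Rightarrow> int) \<times> (nat \<Rightarrow> nat \<Rightarrow> int) \<Rightarrow> real" where
  "local_value d N L \<phi> x t \<omega> =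
     \<phi> ((\<lambda>y. torus_diff d N y x) ` (walk_range d N t \<omega> \<inter> torus_ball d N x L))"

definition Gamma_avg ::
  "nat \<Rightarrow> nat \<Rightarrow> nat \<Rightarrow> ((nat \<Rightarrow> int) set \<Rightarrow> real) \<Rightarrow> real
   \<Rightarrow> (nat \<Rightarrow> int) \<times> (nat \<Rightarrow> nat \<Rightarrow> int) \<Rightarrow> real" where
  "Gamma_avg d N L \<phi> u \<omega> =
     1 / real N ^ d * (\<Sum>x\<in>torus d N. local_value d N L \<phi> x (u * real N ^ d) \<omega>)"

definition sigma_sq :: "nat \<Rightarrow> real \<Rightarrow> nat \<Rightarrow> nat \<Rightarrow> real" where
  "sigma_sq d u L N =
     Inf {(real r / real N) ^ d + u * (real L ^ d / real r) | r :: nat.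
            10 * L \<le> r \<and> real r \<le> real N / 10}"

end

theory Submission
  imports Defs
begin

text \<open>
  The variance of the spatial average at level u is at most a constant times the infimum of
  (r/N)^d + u L^d/r. As c11 > 1 and the average decreases in u, both inequalities then follow from
  Chebyshev's inequality.

  By translation invariance the conditional mean given the starting point is constant, so the
  variance is the sum over the steps of the walk of the variances of the martingale increments.
  In the increment at a step made from y, the sites x within distance of order L of y
  are treated by the Cauchy-Schwarz inequality; since each local value has total variance at
  most 1, they contribute (L/N)^d. For the other sites, the walks following two
  different steps e, e' are coupled by reflection: the separation is j (e - e'), where j is a lazy
  simple random walk started at 1 and absorbed at 0 and N. The expected number of boxes
  hit before the walks merge, apart from those near y, is of order N L^(d-2), because a hit box is
  occupied for a time of order L^2 and merging takes a time of order N. Summing over the u N^d steps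
  gives u L^(2d-4) N^(2-d), which is at most u L^d/N.
\<close>

section \<open>Averages over one step\<close>

text \<open>The value at a box depends on the whole past of the walk, so the effect of one step has
  to be bounded uniformly over the set already visited. The pair of visited set and current position
  is a Markov chain; conditional means are finite recursions over it, and the coupling and optional
  stopping arguments become inductions on the number of remaining steps. On the torus the reflected
  walks merge also at j = N, since N (e - e') vanishes modulo N. Thus j is a gambler's ruin chain
  with two barriers, whose mean duration from 1 is of order N. Hitting is turned into occupation by
  a quadratic function which is at least d L^2 on a box and drops in mean by at most 1 per step, and
  only on its support. The price is a boundary term of order L^2 for boxes near the walks when they
  merge or when time runs out. It is too large if L^2 exceeds N; but to come near a far box the
  walks must first separate or travel by order L, which before merging has probability of order 1/L.
  The boundary term thus drops to order L, hence at most N.\<close>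

definition step_avg :: "nat \<Rightarrow> ((nat \<Rightarrow> int) \<Rightarrow> real) \<Rightarrow> real" where
  "step_avg d g = (\<Sum>s\<in>unit_steps d. g s) / (2 * real d)"

definition step_var :: "nat \<Rightarrow> ((nat \<Rightarrow> int) \<Rightarrow> real) \<Rightarrow> real" where
  "step_var d g = step_avg d (\<lambda>s. (g s)\<^sup>2) - (step_avg d g)\<^sup>2"

lemma sum_unit_steps:
  "(\<Sum>s\<in>unit_steps d. g s) =
     (\<Sum>j<d. g (\<lambda>i. if i = j then 1 else 0) + g (\<lambda>i. if i = j then -1 else 0))"
proof -
  let ?f = "\<lambda>(j, e) i. if i = j then e else (0::int)"
  have im: "unit_steps d = ?f ` ({..<d} \<times> {1, -1})"
    by (auto simp: unit_steps_def image_iff)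
  have inj: "inj_on ?f ({..<d} \<times> {1, -1})"
  proof (rule inj_onI, clarify)
    fix j e j' e'
    assume e: "e \<in> {1, -1::int}" "e' \<in> {1, -1::int}"
      and eq: "(\<lambda>i. if i = j then e else 0) = (\<lambda>i. if i = (j'::nat) then e' else 0)"
    have "(if j = j then e else 0) = (if j = j' then e' else 0)"
      using fun_cong[OF eq, of j] by simp
    then show "j = j' \<and> e = e'"
      using e by (auto split: if_splits)
  qed
  have "(\<Sum>s\<in>unit_steps d. g s) = (\<Sum>p\<in>{..<d} \<times> {1, -1}. g (?f p))"
    unfolding im by (simp add: sum.reindex[OF inj, unfolded o_def])
  also have "\<dots> = (\<Sum>j<d. \<Sum>e\<in>{1, -1}. g (?f (j, e)))"
    by (subst sum.cartesian_product) (rule sum.cong, auto)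
  also have "\<dots> = (\<Sum>j<d. g (?f (j, 1)) + g (?f (j, -1)))"
    by simp
  finally show ?thesis by (simp cong: if_cong)
qed

lemma finite_unit_steps [simp]: "finite (unit_steps d)"
proof -
  have "unit_steps d = (\<lambda>(j, e) i. if i = j then e else 0) ` ({..<d} \<times> {1, -1})"
    by (auto simp: unit_steps_def image_iff)
  then show ?thesis by simp
qed

lemma card_unit_steps: "card (unit_steps d) = 2 * d"
proof -
  have "real (card (unit_steps d)) = (\<Sum>s\<in>unit_steps d. 1)" by simp
  also have "\<dots> = 2 * real d" unfolding sum_unit_steps by simp
  finally show ?thesis by linarith
qed

lemma unit_steps_nonempty: "0 < d \<Longrightarrow> unit_steps d \<noteq> {}"
  using card_unit_steps[of d] by auto

lemma step_avg_mono:
  "(\<And>s. s \<in> unit_steps d \<Longrightarrow> f s \<le> g s) \<Longrightarrow> step_avg d f \<le> step_avg d g"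
  unfolding step_avg_def by (intro divide_right_mono sum_mono) auto

lemma step_avg_cong:
  "(\<And>s. s \<in> unit_steps d \<Longrightarrow> f s = g s) \<Longrightarrow> step_avg d f = step_avg d g"
  unfolding step_avg_def by (simp cong: sum.cong)

lemma step_avg_const [simp]: "0 < d \<Longrightarrow> step_avg d (\<lambda>s. c) = c"
  by (simp add: step_avg_def card_unit_steps)

lemma step_avg_add: "step_avg d (\<lambda>s. f s + g s) = step_avg d f + step_avg d g"
  by (simp add: step_avg_def sum.distrib add_divide_distrib)

lemma step_avg_diff: "step_avg d (\<lambda>s. f s - g s) = step_avg d f - step_avg d g"
  by (simp add: step_avg_def sum_subtractf diff_divide_distrib)

lemma step_avg_cmult: "step_avg d (\<lambda>s. c * f s) = c * step_avg d f"
  by (simp add: step_avg_def sum_distrib_left[symmetric])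

lemma step_avg_sum: "step_avg d (\<lambda>s. \<Sum>x\<in>B. f x s) = (\<Sum>x\<in>B. step_avg d (f x))"
  unfolding step_avg_def by (subst sum.swap) (simp add: sum_divide_distrib)

lemma abs_step_avg_le: "\<bar>step_avg d f\<bar> \<le> step_avg d (\<lambda>s. \<bar>f s\<bar>)"
  unfolding step_avg_def by (simp add: divide_right_mono sum_abs)

lemma step_avg_reindex:
  "bij_betw r (unit_steps d) (unit_steps d) \<Longrightarrow> step_avg d (\<lambda>s. f (r s)) = step_avg d f"
  unfolding step_avg_def by (simp add: sum.reindex_bij_betw)

section \<open>Variance under one step\<close>

lemma step_var_eq:
  assumes "0 < d"
  shows "step_var d g = step_avg d (\<lambda>s. (g s - step_avg d g)\<^sup>2)"
proof -
  let ?m = "step_avg d g"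
  have "step_avg d (\<lambda>s. (g s - ?m)\<^sup>2) = step_avg d (\<lambda>s. (g s)\<^sup>2 - (2 * ?m) * g s + ?m\<^sup>2)"
    by (rule step_avg_cong) (simp add: power2_eq_square algebra_simps)
  also have "\<dots> = step_var d g"
    using assms by (simp add: step_avg_add step_avg_diff step_avg_cmult step_var_def)
      (simp add: power2_eq_square)
  finally show ?thesis ..
qed

lemma step_var_nonneg: "0 < d \<Longrightarrow> 0 \<le> step_var d g"
  using step_avg_mono[of d "\<lambda>s. 0" "\<lambda>s. (g s - step_avg d g)\<^sup>2"] by (simp add: step_var_eq)

lemma step_var_cmult: "step_var d (\<lambda>s. c * g s) = c\<^sup>2 * step_var d g"
  by (simp add: step_var_def step_avg_cmult power_mult_distrib algebra_simps)

lemma step_var_add_le: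
  assumes "0 < d"
  shows "step_var d (\<lambda>s. f s + g s) \<le> 2 * step_var d f + 2 * step_var d g"
proof -
  have *: "(a + b)\<^sup>2 \<le> 2 * a\<^sup>2 + 2 * b\<^sup>2" for a b :: real
    using zero_le_power2[of "a - b"] by (simp add: power2_eq_square algebra_simps)
  have "step_var d (\<lambda>s. f s + g s)
      = step_avg d (\<lambda>s. ((f s - step_avg d f) + (g s - step_avg d g))\<^sup>2)"
    using assms by (simp add: step_var_eq step_avg_add algebra_simps)
  also have "\<dots> \<le> step_avg d (\<lambda>s. 2 * (f s - step_avg d f)\<^sup>2 + 2 * (g s - step_avg d g)\<^sup>2)"
    by (intro step_avg_mono *)
  finally show ?thesis
    using assms by (simp add: step_var_eq step_avg_add step_avg_cmult)
qed

text \<open>Cauchy-Schwarz for the centred values. The factor \<open>card B\<close> is affordable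
  only for the few sites near the walk.\<close>

lemma step_var_sum_le:
  assumes "0 < d"
  shows "step_var d (\<lambda>s. \<Sum>x\<in>B. f x s) \<le> real (card B) * (\<Sum>x\<in>B. step_var d (f x))"
proof -
  have "step_var d (\<lambda>s. \<Sum>x\<in>B. f x s)
      = step_avg d (\<lambda>s. (\<Sum>x\<in>B. f x s - step_avg d (f x))\<^sup>2)"
    using assms by (simp add: step_var_eq step_avg_sum sum_subtractf)
  also have "\<dots> \<le> step_avg d (\<lambda>s. real (card B) * (\<Sum>x\<in>B. (f x s - step_avg d (f x))\<^sup>2))"
    by (intro step_avg_mono) (metis mult.commute sum_squared_le_sum_of_squares)
  finally show ?thesis
    using assms by (simp add: step_var_eq step_avg_sum step_avg_cmult)
qed

lemma step_var_le_osc: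
  assumes "0 < d"
    and osc: "\<And>s t. s \<in> unit_steps d \<Longrightarrow> t \<in> unit_steps d \<Longrightarrow> \<bar>g s - g t\<bar> \<le> \<delta>"
  shows "step_var d g \<le> \<delta>\<^sup>2"
proof -
  have "(g s - step_avg d g)\<^sup>2 \<le> \<delta>\<^sup>2" if s: "s \<in> unit_steps d" for s
  proof -
    have "\<bar>g s - step_avg d g\<bar> = \<bar>step_avg d (\<lambda>t. g s - g t)\<bar>"
      using assms(1) by (simp add: step_avg_diff)
    also have "\<dots> \<le> step_avg d (\<lambda>t. \<bar>g s - g t\<bar>)" by (rule abs_step_avg_le)
    also have "\<dots> \<le> step_avg d (\<lambda>t. \<delta>)" using s by (intro step_avg_mono osc)
    finally show ?thesis using assms(1) by (simp add: abs_le_square_iff[symmetric])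
  qed
  then have "step_avg d (\<lambda>s. (g s - step_avg d g)\<^sup>2) \<le> step_avg d (\<lambda>s. \<delta>\<^sup>2)"
    by (intro step_avg_mono)
  then show ?thesis using assms(1) by (simp add: step_var_eq)
qed

section \<open>Distances on the torus\<close>

definition circle_norm :: "nat \<Rightarrow> int \<Rightarrow> int" where
  "circle_norm N k = min (k mod int N) ((- k) mod int N)"

lemma circle_dist_eq: "circle_dist N a b = circle_norm N (a - b)"
  by (simp add: circle_dist_def circle_norm_def)

lemma circle_norm_minus: "circle_norm N (- k) = circle_norm N k"
  by (simp add: circle_norm_def min.commute)

lemma circle_norm_add_multiple [simp]: "circle_norm N (k + m * int N) = circle_norm N k"
proof -
  have "- (k + m * int N) = - k + (- m) * int N" by simp
  then show ?thesis unfolding circle_norm_def by (metis mod_mult_self1)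
qed

lemma circle_norm_nonneg: "0 < N \<Longrightarrow> 0 \<le> circle_norm N k"
  by (simp add: circle_norm_def)

lemma circle_norm_le_abs:
  assumes "0 < N" shows "circle_norm N k \<le> \<bar>k\<bar>"
proof (cases "k \<ge> 0")
  case True
  then have "k mod int N \<le> k" by (simp add: zmod_le_nonneg_dividend)
  then show ?thesis by (simp add: circle_norm_def)
next
  case False
  then have "(- k) mod int N \<le> - k" by (intro zmod_le_nonneg_dividend) simp
  then show ?thesis by (simp add: circle_norm_def)
qed

text \<open>The minimum of \<bar>k + m N\<bar> over m is attained; together with
  \<open>circle_norm_le_abs\<close> this reduces inequalities modulo N to inequalities between
  integers.\<close>

lemma circle_norm_representative:
  assumes "0 < N" obtains m where "circle_norm N k = \<bar>k + m * int N\<bar>"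
proof (cases "k mod int N \<le> (- k) mod int N")
  case True
  have "k mod int N = k + (- (k div int N)) * int N"
    by (simp add: minus_div_mult_eq_mod[symmetric])
  moreover have "0 \<le> k mod int N" using assms by simp
  ultimately have "circle_norm N k = \<bar>k + (- (k div int N)) * int N\<bar>"
    using True by (simp add: circle_norm_def)
  then show ?thesis using that by blast
next
  case False
  have "(- k) mod int N = - (k + ((- k) div int N) * int N)"
    by (simp add: minus_div_mult_eq_mod[symmetric])
  moreover have "0 \<le> (- k) mod int N" using assms by simp
  ultimately have "circle_norm N k = \<bar>k + ((- k) div int N) * int N\<bar>"
    using False by (simp add: circle_norm_def)
  then show ?thesis using that by blast
qed

lemma circle_norm_triangle:
  assumes "0 < N" shows "circle_norm N (k + l) \<le> circle_norm N k + circle_norm N l"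
proof -
  obtain m where m: "circle_norm N k = \<bar>k + m * int N\<bar>"
    using circle_norm_representative[OF assms] .
  obtain n where n: "circle_norm N l = \<bar>l + n * int N\<bar>"
    using circle_norm_representative[OF assms] .
  have "circle_norm N (k + l) = circle_norm N ((k + m * int N) + (l + n * int N))"
    using circle_norm_add_multiple[of N "k + l" "m + n"] by (simp add: algebra_simps)
  also have "\<dots> \<le> \<bar>(k + m * int N) + (l + n * int N)\<bar>"
    by (rule circle_norm_le_abs[OF assms])
  finally show ?thesis using m n by linarith
qed

text \<open>At the best representative \<open>q\<close> the squared norm is \<open>q * q\<close>, a
  parabola with second difference 2. Its neighbours can only be closer to 0 modulo N than
  \<open>q + 1\<close> and \<open>q - 1\<close> are to 0, which settles the cut point opposite to
  0.\<close>

lemma circle_norm_steps: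
  assumes "0 < N"
  shows "(circle_norm N (k + 1))\<^sup>2 + (circle_norm N (k - 1))\<^sup>2 \<le> 2 * (circle_norm N k)\<^sup>2 + 2"
proof -
  obtain m where m: "circle_norm N k = \<bar>k + m * int N\<bar>"
    using circle_norm_representative[OF assms] .
  define q where "q = k + m * int N"
  have "circle_norm N (k + 1) = circle_norm N (q + 1)"
    using circle_norm_add_multiple[of N "k + 1" m] by (simp add: q_def algebra_simps)
  moreover have "circle_norm N (k - 1) = circle_norm N (q - 1)"
    using circle_norm_add_multiple[of N "k - 1" m] by (simp add: q_def algebra_simps)
  moreover have "(circle_norm N l)\<^sup>2 \<le> l\<^sup>2" for l
    using circle_norm_le_abs[OF assms, of l] circle_norm_nonneg[OF assms, of l]
    by (simp add: abs_le_square_iff[symmetric])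
  ultimately have "(circle_norm N (k + 1))\<^sup>2 + (circle_norm N (k - 1))\<^sup>2 \<le> (q + 1)\<^sup>2 + (q - 1)\<^sup>2"
    by (simp add: add_mono)
  also have "\<dots> = 2 * q\<^sup>2 + 2" by (simp add: power2_eq_square algebra_simps)
  finally show ?thesis by (simp add: m q_def)
qed

section \<open>Mean growth of the squared distance\<close>

definition torus_norm_sq :: "nat \<Rightarrow> nat \<Rightarrow> (nat \<Rightarrow> int) \<Rightarrow> real" where
  "torus_norm_sq d N z = (\<Sum>i<d. (real_of_int (circle_norm N (z i)))\<^sup>2)"

lemma torus_norm_sq_nonneg: "0 \<le> torus_norm_sq d N z"
  by (simp add: torus_norm_sq_def sum_nonneg)

lemma circle_norm_le_torus_norm_sq:
  "i < d \<Longrightarrow> (real_of_int (circle_norm N (z i)))\<^sup>2 \<le> torus_norm_sq d N z"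
  unfolding torus_norm_sq_def
  by (rule member_le_sum[where f = "\<lambda>i. (real_of_int (circle_norm N (z i)))\<^sup>2"]) auto

text \<open>Torus version of the fact that squared distance minus time is a martingale: each of the
  d coordinates contributes a second difference of at most 2, with weight 1/(2d). Wrapping around
  the torus leaves only an inequality.\<close>

lemma step_avg_torus_norm_sq_le:
  assumes "0 < d" "0 < N"
  shows "step_avg d (\<lambda>s. torus_norm_sq d N (\<lambda>i. z i + s i)) \<le> torus_norm_sq d N z + 1"
proof -
  let ?q = "\<lambda>k. (real_of_int (circle_norm N k))\<^sup>2"
  have upd: "torus_norm_sq d N (\<lambda>i. z i + (if i = j then e else 0))
      = torus_norm_sq d N z + (?q (z j + e) - ?q (z j))" if "j < d" for j e
  proof -
    have "torus_norm_sq d N (\<lambda>i. z i + (if i = j then e else 0)) - torus_norm_sq d N z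
        = (\<Sum>i<d. if i = j then ?q (z j + e) - ?q (z j) else 0)"
      unfolding torus_norm_sq_def sum_subtractf[symmetric] by (intro sum.cong) auto
    also have "\<dots> = ?q (z j + e) - ?q (z j)" using that by simp
    finally show ?thesis by simp
  qed
  have "(\<Sum>s\<in>unit_steps d. torus_norm_sq d N (\<lambda>i. z i + s i))
      = (\<Sum>j<d. 2 * torus_norm_sq d N z + (?q (z j + 1) + ?q (z j - 1) - 2 * ?q (z j)))"
    unfolding sum_unit_steps by (intro sum.cong) (auto simp: upd)
  also have "\<dots> \<le> (\<Sum>j<d. 2 * torus_norm_sq d N z + 2)"
  proof (intro sum_mono add_left_mono)
    fix j
    have "real_of_int ((circle_norm N (z j + 1))\<^sup>2 + (circle_norm N (z j - 1))\<^sup>2)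
        \<le> real_of_int (2 * (circle_norm N (z j))\<^sup>2 + 2)"
      using circle_norm_steps[OF assms(2), of "z j"] by (simp only: of_int_le_iff)
    then show "?q (z j + 1) + ?q (z j - 1) - 2 * ?q (z j) \<le> 2" by simp
  qed
  also have "\<dots> = (2 * real d) * (torus_norm_sq d N z + 1)" by (simp add: algebra_simps)
  finally show ?thesis using assms(1) by (simp add: step_avg_def divide_le_eq mult.commute)
qed

lemma card_torus_box_le:
  "card {x \<in> torus d N. \<forall>i<d. circle_norm N (z i - x i) \<le> int m} \<le> (2 * m + 1) ^ d"
proof -
  let ?I = "\<lambda>i. {k \<in> {0..<int N}. circle_norm N (z i - k) \<le> int m}"
  have fin: "finite (?I i)" for i by (rule finite_subset[of _ "{0..<int N}"]) auto
  have le: "card (?I i) \<le> 2 * m + 1" for i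
  proof -
    have "?I i \<subseteq> (\<lambda>t. (z i + t) mod int N) ` {- int m..int m}"
    proof
      fix k assume k: "k \<in> ?I i"
      then have N: "0 < N" by auto
      obtain n where "circle_norm N (z i - k) = \<bar>(z i - k) + n * int N\<bar>"
        using circle_norm_representative[OF N] .
      with k have b: "\<bar>(z i - k) + n * int N\<bar> \<le> int m" by simp
      define t where "t = - ((z i - k) + n * int N)"
      have "z i + t = k + (- n) * int N" by (simp add: t_def)
      then have "(z i + t) mod int N = k mod int N" by (metis mod_mult_self1)
      also have "\<dots> = k" using k by simp
      finally have "k = (z i + t) mod int N" ..
      moreover have "t \<in> {- int m..int m}" using b by (auto simp: t_def)
      ultimately show "k \<in> (\<lambda>t. (z i + t) mod int N) ` {- int m..int m}" by blast
    qed
    then have "card (?I i) \<le> card {- int m..int m}"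
      by (rule surj_card_le[OF finite_atLeastAtMost_int])
    then show ?thesis by simp
  qed
  have "{x \<in> torus d N. \<forall>i<d. circle_norm N (z i - x i) \<le> int m} = PiE {..<d} ?I"
    unfolding torus_def PiE_def by (intro set_eqI) (simp add: Pi_iff, blast)
  then have "card {x \<in> torus d N. \<forall>i<d. circle_norm N (z i - x i) \<le> int m} = (\<Prod>i<d. card (?I i))"
    by (simp add: card_PiE)
  also have "\<dots> \<le> (\<Prod>i<d. 2 * m + 1)" by (intro prod_mono conjI le) simp
  finally show ?thesis by simp
qed

section \<open>The reflection coupling\<close>

lemma unit_step_cases:
  assumes "s \<in> unit_steps d"
  obtains j e where "j < d" "e \<in> {1, -1}" "s = (\<lambda>i. if i = j then e else 0)"
  using assms by (auto simp: unit_steps_def)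

lemma uminus_unit_step: "s \<in> unit_steps d \<Longrightarrow> (\<lambda>i. - s i) \<in> unit_steps d"
proof (elim unit_step_cases)
  fix j e assume j: "j < d" and e: "e \<in> {1, -1::int}" and s: "s = (\<lambda>i. if i = j then e else 0)"
  have "(\<lambda>i. - s i) = (\<lambda>i. if i = j then - e else 0)" by (auto simp: s)
  moreover have "- e \<in> {1, -1}" using e by auto
  ultimately show ?thesis using j unfolding unit_steps_def by blast
qed

lemma unit_step_neq_uminus: "s \<in> unit_steps d \<Longrightarrow> s \<noteq> (\<lambda>i. - s i)"
proof (elim unit_step_cases)
  fix j e assume e: "e \<in> {1, -1::int}" and s: "s = (\<lambda>i. if i = j then e else 0)"
  show ?thesis
  proof
    assume "s = (\<lambda>i. - s i)"
    then have "s j = - s j" by (rule fun_cong)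
    then show False using e by (auto simp: s)
  qed
qed

lemma abs_unit_step_le: "s \<in> unit_steps d \<Longrightarrow> \<bar>s i\<bar> \<le> 1"
  by (elim unit_step_cases) auto

text \<open>When the first walk makes the step s, its partner makes the step \<open>r s\<close>, and
  the separation j D becomes (j + c s) D. Since \<open>c\<close> takes values in {-1, 0, 1}, j
  cannot jump over 0 or N; its second moment keeps j from being too lazy and so bounds the merging
  time.\<close>

locale reflected_steps =
  fixes d N :: nat and D :: "nat \<Rightarrow> int"
    and c :: "(nat \<Rightarrow> int) \<Rightarrow> int" and r :: "(nat \<Rightarrow> int) \<Rightarrow> nat \<Rightarrow> int"
  assumes d_pos: "0 < d" and N_pos: "0 < N"
    and r_bij: "bij_betw r (unit_steps d) (unit_steps d)"
    and c_range: "s \<in> unit_steps d \<Longrightarrow> c s \<in> {-1, 0, 1}"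
    and r_eq: "s \<in> unit_steps d \<Longrightarrow> r s = (\<lambda>i. s i - c s * D i)"
    and c_mean: "step_avg d (\<lambda>s. real_of_int (c s)) = 0"
    and c_second_moment: "1 / real d \<le> step_avg d (\<lambda>s. (real_of_int (c s))\<^sup>2)"
    and D_bound: "\<bar>D i\<bar> \<le> 2"

text \<open>
  The reflection in the hyperplane orthogonal to e - e' exchanges e and e', and permutes the steps.
\<close>

lemma reflected_steps_exist:
  assumes d: "0 < d" and N: "0 < N"
    and e: "e \<in> unit_steps d" and e': "e' \<in> unit_steps d" and ne: "e \<noteq> e'"
  obtains c r where "reflected_steps d N (\<lambda>i. e i - e' i) c r"
proof -
  let ?U = "unit_steps d" and ?m = "\<lambda>(s :: nat \<Rightarrow> int) i. - s i"
  \<comment> \<open>This is the reflection coefficient 2 (s . D) / (D . D) for D = e - e'. If e' = -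
    e, the two alternatives in each disjunction coincide.\<close>
  define c :: "(nat \<Rightarrow> int) \<Rightarrow> int" where
    "c s = (if s = e \<or> s = ?m e' then 1 else if s = e' \<or> s = ?m e then -1 else 0)" for s
  define r where "r s = (\<lambda>i. s i - c s * (e i - e' i))" for s
  have mm: "?m s = ?m t \<longleftrightarrow> s = t" "s = ?m t \<longleftrightarrow> t = ?m s" for s t
    by (auto simp: fun_eq_iff equation_minus_iff)
  have ce: "c e = 1" "c (?m e') = 1" "c e' = -1" "c (?m e) = -1"
    using ne unit_step_neq_uminus[OF e] unit_step_neq_uminus[OF e'] mm(1)[of e e']
    by (auto simp: c_def)
  have re: "r e = e'" "r (?m e') = ?m e" "r e' = e" "r (?m e) = ?m e'"
    unfolding r_def ce by auto
  have rid: "r s = s" if "c s = 0" for s using that by (simp add: r_def)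
  have cases: "s = e \<or> s = ?m e' \<or> s = e' \<or> s = ?m e \<or> c s = 0" for s
    by (simp add: c_def)
  have rU: "r s \<in> ?U" if "s \<in> ?U" for s
    using cases[of s] e e' that uminus_unit_step by (auto simp: re rid)
  have rr: "r (r s) = s" for s
    using cases[of s] by (auto simp: re rid)
  have cr: "c (r s) = - c s" for s
    using cases[of s] by (auto simp: re rid ce)
  have bij: "bij_betw r ?U ?U"
    by (rule bij_betw_byWitness[where f' = r]) (auto simp: rr rU)
  have "step_avg d (\<lambda>s. real_of_int (c s)) = step_avg d (\<lambda>s. real_of_int (c (r s)))"
    using step_avg_reindex[OF bij, of "\<lambda>s. real_of_int (c s)"] by simp
  also have "\<dots> = - step_avg d (\<lambda>s. real_of_int (c s))"
    using step_avg_cmult[of d "-1" "\<lambda>s. real_of_int (c s)"] by (simp add: cr)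
  finally have mean: "step_avg d (\<lambda>s. real_of_int (c s)) = 0" by simp
  \<comment> \<open>Only e and e' are counted: for e' = - e no other step moves j, so 1/d is then
    the exact second moment.\<close>
  have "2 = (\<Sum>s\<in>{e, e'}. (real_of_int (c s))\<^sup>2)" using ne by (simp add: ce)
  also have "\<dots> \<le> (\<Sum>s\<in>?U. (real_of_int (c s))\<^sup>2)"
    using e e' by (intro sum_mono2) auto
  finally have second: "1 / real d \<le> step_avg d (\<lambda>s. (real_of_int (c s))\<^sup>2)"
    using d by (simp add: step_avg_def field_simps)
  have "reflected_steps d N (\<lambda>i. e i - e' i) c r"
  proof
    show "\<bar>e i - e' i\<bar> \<le> 2" for i
      using abs_unit_step_le[OF e, of i] abs_unit_step_le[OF e', of i] by linarith
    show "c s \<in> {-1, 0, 1}" for s by (simp add: c_def)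
  qed (use d N bij mean second in \<open>auto simp: r_def\<close>)
  then show ?thesis by (rule that)
qed

section \<open>Lifted walks and conditional means given the visited set\<close>

definition torus_proj :: "nat \<Rightarrow> nat \<Rightarrow> (nat \<Rightarrow> int) \<Rightarrow> nat \<Rightarrow> int" where
  "torus_proj d N z = (\<lambda>i\<in>{..<d}. z i mod int N)"

lemma torus_add_proj: "torus_add d N (torus_proj d N z) s = torus_proj d N (\<lambda>i. z i + s i)"
  by (auto simp: torus_add_def torus_proj_def mod_add_left_eq restrict_def)

lemma torus_proj_in_torus: "0 < N \<Longrightarrow> torus_proj d N z \<in> torus d N"
  by (auto simp: torus_proj_def torus_def)

lemma torus_proj_id: "y \<in> torus d N \<Longrightarrow> torus_proj d N y = y"
  by (force simp: torus_proj_def torus_def PiE_iff extensional_def restrict_def)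

text \<open>The coupled walks live in integer coordinates, where the multiple j keeps its meaning;
  by this identity they agree on the torus at j = N as well as at j = 0.\<close>

lemma torus_proj_diff_multiple:
  "torus_proj d N (\<lambda>i. z i - int N * D i) = torus_proj d N z"
proof -
  have "(k - int N * m) mod int N = k mod int N" for k m
    by (metis mod_mult_self4 mult_minus_right uminus_add_conv_diff add.commute)
  then show ?thesis by (simp add: torus_proj_def)
qed

text \<open>The conditional mean of F of the range when n steps remain, the walk is at y and A has
  been visited before. The set A has to be carried along because position alone does not determine
  the future value of F.\<close>

primrec range_mean :: "nat \<Rightarrow> nat \<Rightarrow> nat \<Rightarrow> ((nat \<Rightarrow> int) set \<Rightarrow> real) \<Rightarrow>
    (nat \<Rightarrow> int) set \<Rightarrow> (nat \<Rightarrow> int) \<Rightarrow> real" where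
  "range_mean d N 0 F A y = F (insert y A)"
| "range_mean d N (Suc n) F A y =
     step_avg d (\<lambda>s. range_mean d N n F (insert y A) (torus_add d N y s))"

text \<open>A site which F ignores may be dropped from the history. Hence two walks that have not
  met the box can be compared for one and the same A.\<close>

lemma range_mean_insert:
  assumes "\<And>B. F (insert p B) = F B"
  shows "range_mean d N n F (insert p A) y = range_mean d N n F A y"
proof (induction n arbitrary: A y)
  case 0
  show ?case using assms by (simp add: insert_commute[of y p])
next
  case (Suc n)
  show ?case by (simp add: insert_commute[of y p] Suc.IH)
qed

lemma range_mean_mono:
  "(\<And>A. F A \<le> G A) \<Longrightarrow> range_mean d N n F A y \<le> range_mean d N n G A y"
  by (induction n arbitrary: A y) (auto intro: step_avg_mono)

lemma range_mean_const: "0 < d \<Longrightarrow> range_mean d N n (\<lambda>A. c) A y = c"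
  by (induction n arbitrary: A y) auto

lemma range_mean_cmult:
  "range_mean d N n (\<lambda>A. c * F A) A y = c * range_mean d N n F A y"
  by (induction n arbitrary: A y) (auto simp: step_avg_cmult)

lemma range_mean_sum:
  "range_mean d N n (\<lambda>A. \<Sum>x\<in>X. F x A) A y = (\<Sum>x\<in>X. range_mean d N n (F x) A y)"
  by (induction n arbitrary: A y) (auto simp: step_avg_sum)

section \<open>Coupled pairs up to merging\<close>

context reflected_steps
begin

abbreviation partner :: "(nat \<Rightarrow> int) \<Rightarrow> int \<Rightarrow> nat \<Rightarrow> int" where
  "partner a j \<equiv> (\<lambda>i. a i - j * D i)"

lemma partner_step:
  assumes "s \<in> unit_steps d"
  shows "partner (\<lambda>i. a i + s i) (j + c s) = (\<lambda>i. partner a j i + r s i)"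
  by (auto simp: r_eq[OF assms] algebra_simps)

text \<open>Because \<open>r\<close> permutes the steps, the partner is itself a simple random walk:
  this is the marginal property of the coupling.\<close>

lemma step_avg_partner:
  "step_avg d (\<lambda>s. g (partner (\<lambda>i. a i + s i) (j + c s))) = step_avg d (\<lambda>s. g (\<lambda>i. partner a j i + s i))"
proof -
  have "step_avg d (\<lambda>s. g (partner (\<lambda>i. a i + s i) (j + c s)))
      = step_avg d (\<lambda>s. g (\<lambda>i. partner a j i + r s i))"
    by (rule step_avg_cong) (simp only: partner_step)
  then show ?thesis
    using step_avg_reindex[OF r_bij, of "\<lambda>s. g (\<lambda>i. partner a j i + s i)"] by simp
qed

text \<open>
  The walks from a and from its mirror image merge when the multiple j of D separating them
  reaches 0 or N. Apart from boundary values, the function below is the expected time before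
  merging that the two walks spend in the support of K.
\<close>

primrec occupation :: "((nat \<Rightarrow> int) \<Rightarrow> real) \<Rightarrow> nat \<Rightarrow> (nat \<Rightarrow> int) \<Rightarrow> int \<Rightarrow> real" where
  "occupation K 0 a j = K a + K (partner a j)"
| "occupation K (Suc n) a j =
     (if j \<le> 0 \<or> int N \<le> j then K a + K (partner a j)
      else of_bool (0 < K a) + of_bool (0 < K (partner a j))
        + step_avg d (\<lambda>s. occupation K n (\<lambda>i. a i + s i) (j + c s)))"

text \<open>Dynkin's formula as an induction: K drops in mean by at most 1 per step, and only on its
  support, so its present value is at most the expected time there plus its value at stopping. This
  is why the boundary values of \<open>occupation\<close> are values of K.\<close>

lemma occupation_ge:
  assumes K: "\<And>z. K z \<le> step_avg d (\<lambda>s. K (\<lambda>i. z i + s i)) + of_bool (0 < K z)"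
  shows "K a + K (partner a j) \<le> occupation K n a j"
proof (induction n arbitrary: a j)
  case (Suc n)
  have "K a + K (partner a j)
      \<le> of_bool (0 < K a) + of_bool (0 < K (partner a j))
        + (step_avg d (\<lambda>s. K (\<lambda>i. a i + s i)) + step_avg d (\<lambda>s. K (\<lambda>i. partner a j i + s i)))"
    using K[of a] K[of "partner a j"] by linarith
  also have "step_avg d (\<lambda>s. K (\<lambda>i. a i + s i)) + step_avg d (\<lambda>s. K (\<lambda>i. partner a j i + s i))
      = step_avg d (\<lambda>s. K (\<lambda>i. a i + s i) + K (partner (\<lambda>i. a i + s i) (j + c s)))"
    by (simp add: step_avg_add step_avg_partner)
  also have "\<dots> \<le> step_avg d (\<lambda>s. occupation K n (\<lambda>i. a i + s i) (j + c s))"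
    by (intro step_avg_mono Suc.IH)
  finally show ?case by auto
qed simp

text \<open>While both walks stay in {K < \<kappa>}, F does not see them, and the difference of the
  means is the average of the differences after one coupled step. At a merging it is 0. At a hit it
  is only known to be at most 1, but then K, and with it \<open>occupation\<close>, is at least
  \<kappa>.\<close>

lemma range_mean_partner_diff_le:
  assumes F: "\<And>A. 0 \<le> F A" "\<And>A. F A \<le> 1"
    and \<kappa>: "0 < \<kappa>"
    and F_off: "\<And>a A. K a < \<kappa> \<Longrightarrow> F (insert (torus_proj d N a) A) = F A"
    and K_nonneg: "\<And>z. 0 \<le> K z"
    and K: "\<And>z. K z \<le> step_avg d (\<lambda>s. K (\<lambda>i. z i + s i)) + of_bool (0 < K z)"
    and j: "0 \<le> j" "j \<le> int N"
  shows "\<bar>range_mean d N n F A (torus_proj d N a) - range_mean d N n F A (torus_proj d N (partner a j))\<bar>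
    \<le> occupation K n a j / \<kappa>"
proof -
  have RM: "0 \<le> range_mean d N n F A y" "range_mean d N n F A y \<le> 1" for n A y
    using range_mean_mono[of "\<lambda>_. 0" F d N n A y] range_mean_mono[of F "\<lambda>_. 1" d N n A y]
    by (auto simp: range_mean_const[OF d_pos] F)
  have hit: "\<bar>range_mean d N n F A (torus_proj d N a) - range_mean d N n F A (torus_proj d N (partner a j))\<bar>
      \<le> occupation K n a j / \<kappa>" if "\<kappa> \<le> K a \<or> \<kappa> \<le> K (partner a j)" for n A a j
  proof -
    have "\<kappa> \<le> K a + K (partner a j)"
      using that K_nonneg[of a] K_nonneg[of "partner a j"] by linarith
    also have "\<dots> \<le> occupation K n a j" by (rule occupation_ge[OF K])
    finally have "1 \<le> occupation K n a j / \<kappa>" using \<kappa> by simp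
    then show ?thesis
      using RM[of n A "torus_proj d N a"] RM[of n A "torus_proj d N (partner a j)"] by linarith
  qed
  show ?thesis
    using j
  proof (induction n arbitrary: A a j)
    case 0
    have "0 \<le> occupation K 0 a j / \<kappa>" using K_nonneg \<kappa> by simp
    then show ?case
      using hit[of a j 0 A] F_off[of a A] F_off[of "partner a j" A] by (cases "\<kappa> \<le> K a \<or> \<kappa> \<le> K (partner a j)") auto
  next
    case (Suc n)
    show ?case
    proof (cases "\<kappa> \<le> K a \<or> \<kappa> \<le> K (partner a j)")
      case True
      then show ?thesis by (rule hit)
    next
      case False
      show ?thesis
      proof (cases "j \<le> 0 \<or> int N \<le> j")
        case True
        then have "j = 0 \<or> j = int N" using Suc.prems by linarith
        then have "torus_proj d N (partner a j) = torus_proj d N a"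
          using torus_proj_diff_multiple[of d N a D] by auto
        then show ?thesis using True K_nonneg \<kappa> by simp
      next
        case False2: False
        let ?g = "\<lambda>z. range_mean d N n F A (torus_proj d N z)"
        have off: "range_mean d N (Suc n) F A (torus_proj d N b) = step_avg d (\<lambda>s. ?g (\<lambda>i. b i + s i))"
          if "K b < \<kappa>" for b
        proof -
          have "F (insert (torus_proj d N b) B) = F B" for B by (rule F_off[OF that])
          then show ?thesis by (simp add: range_mean_insert torus_add_proj)
        qed
        have "\<bar>range_mean d N (Suc n) F A (torus_proj d N a)
              - range_mean d N (Suc n) F A (torus_proj d N (partner a j))\<bar>
            = \<bar>step_avg d (\<lambda>s. ?g (\<lambda>i. a i + s i) - ?g (partner (\<lambda>i. a i + s i) (j + c s)))\<bar>"
          using False off[of a] off[of "partner a j"] step_avg_partner[of ?g a j]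
          by (simp add: step_avg_diff not_le)
        also have "\<dots> \<le> step_avg d (\<lambda>s. \<bar>?g (\<lambda>i. a i + s i) - ?g (partner (\<lambda>i. a i + s i) (j + c s))\<bar>)"
          by (rule abs_step_avg_le)
        also have "\<dots> \<le> step_avg d (\<lambda>s. (1 / \<kappa>) * occupation K n (\<lambda>i. a i + s i) (j + c s))"
        proof (rule step_avg_mono)
          fix s assume "s \<in> unit_steps d"
          then have "0 \<le> j + c s" "j + c s \<le> int N" using c_range[of s] False2 by auto
          then show "\<bar>?g (\<lambda>i. a i + s i) - ?g (partner (\<lambda>i. a i + s i) (j + c s))\<bar>
              \<le> (1 / \<kappa>) * occupation K n (\<lambda>i. a i + s i) (j + c s)"
            using Suc.IH[of "j + c s" A "\<lambda>i. a i + s i"] by simp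
        qed
        also have "\<dots> \<le> occupation K (Suc n) a j / \<kappa>"
          unfolding step_avg_cmult using False2 \<kappa> by (simp add: divide_right_mono)
        finally show ?thesis .
      qed
    qed
  qed
qed

text \<open>A position lies in at most k supports, so all sites together cost at most 2 k per step
  before merging, and d j (N - j), which drops in mean by at least 1 per step, bounds the number of
  steps. The values at stopping sum to at most 2 k M and vanish unless \<Theta> is at least 1, so
  the supermartingale \<Theta> bounds their mean.\<close>

lemma sum_occupation_le:
  assumes X: "finite X"
    and K: "\<And>x z. x \<in> X \<Longrightarrow> 0 \<le> K x z" "\<And>x z. x \<in> X \<Longrightarrow> K x z \<le> M"
    and supp: "\<And>z. card {x \<in> X. 0 < K x z} \<le> k"
    and \<Theta>_nonneg: "\<And>a j. 0 \<le> j \<Longrightarrow> 0 \<le> \<Theta> a j"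
    and \<Theta>_one: "\<And>a j x. 0 \<le> j \<Longrightarrow> \<Theta> a j < 1 \<Longrightarrow> x \<in> X \<Longrightarrow> K x a = 0 \<and> K x (partner a j) = 0"
    and \<Theta>_super: "\<And>a j. 0 < j \<Longrightarrow> step_avg d (\<lambda>s. \<Theta> (\<lambda>i. a i + s i) (j + c s)) \<le> \<Theta> a j"
    and M: "0 \<le> M" and j: "0 \<le> j" "j \<le> int N"
  shows "(\<Sum>x\<in>X. occupation (K x) n a j)
    \<le> 2 * real k * (M * \<Theta> a j + real d * (real_of_int j * (real N - real_of_int j)))"
proof -
  let ?T = "\<lambda>j. real d * (real_of_int j * (real N - real_of_int j))"
  have visits: "(\<Sum>x\<in>X. of_bool (0 < K x z)) \<le> real k" for z
  proof -
    have "(\<Sum>x\<in>X. of_bool (0 < K x z)) = real (card {x \<in> X. 0 < K x z})"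
      using X by (simp add: of_bool_def sum.If_cases Int_def)
    then show ?thesis using supp[of z] by simp
  qed
  have sumK: "(\<Sum>x\<in>X. K x z) \<le> real k * M" for z
  proof -
    have "(\<Sum>x\<in>X. K x z) \<le> (\<Sum>x\<in>X. of_bool (0 < K x z) * M)"
      using K by (intro sum_mono) (auto simp: not_less)
    also have "\<dots> \<le> real k * M"
      unfolding sum_distrib_right[symmetric] by (intro mult_right_mono visits M)
    finally show ?thesis .
  qed
  have T: "0 \<le> ?T j" if "0 \<le> j" "j \<le> int N" for j
    using that by (intro mult_nonneg_nonneg) auto
  have stop: "(\<Sum>x\<in>X. K x a + K x (partner a j)) \<le> 2 * real k * (M * \<Theta> a j + ?T j)"
    if j: "0 \<le> j" "j \<le> int N" for a j
  proof (cases "\<Theta> a j < 1")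
    case True
    have "(\<Sum>x\<in>X. K x a + K x (partner a j)) = 0"
      by (rule sum.neutral) (use \<Theta>_one[OF j(1) True] in auto)
    then show ?thesis using T[OF j] \<Theta>_nonneg[OF j(1)] M by simp
  next
    case False
    have "(\<Sum>x\<in>X. K x a + K x (partner a j)) \<le> 2 * (real k * M)"
      using sumK[of a] sumK[of "partner a j"] by (simp add: sum.distrib)
    also have "\<dots> = 2 * real k * (M * 1)" by simp
    also have "\<dots> \<le> 2 * real k * (M * \<Theta> a j + ?T j)"
    proof (rule mult_left_mono)
      have "M * 1 \<le> M * \<Theta> a j" using False M by (intro mult_left_mono) auto
      then show "M * 1 \<le> M * \<Theta> a j + ?T j" using T[OF j] by linarith
    qed simp
    finally show ?thesis .
  qed
  show ?thesis
    using j
  proof (induction n arbitrary: a j)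
    case 0
    then show ?case using stop by simp
  next
    case (Suc n)
    show ?case
    proof (cases "j \<le> 0 \<or> int N \<le> j")
      case True
      then show ?thesis using stop[OF Suc.prems] by auto
    next
      case False
      have Tavg: "step_avg d (\<lambda>s. ?T (j + c s)) \<le> ?T j - 1"
      proof -
        let ?c = "\<lambda>s. real_of_int (c s)"
        have "step_avg d (\<lambda>s. ?T (j + c s))
            = step_avg d (\<lambda>s. ?T j + (real d * (real N - 2 * real_of_int j)) * ?c s - real d * (?c s)\<^sup>2)"
          by (rule step_avg_cong) (simp add: algebra_simps power2_eq_square)
        also have "\<dots> = ?T j - real d * step_avg d (\<lambda>s. (?c s)\<^sup>2)"
          using d_pos by (simp add: step_avg_add step_avg_diff step_avg_cmult c_mean)
        also have "\<dots> \<le> ?T j - 1"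
          using c_second_moment d_pos by (simp add: field_simps)
        finally show ?thesis .
      qed
      have "(\<Sum>x\<in>X. occupation (K x) (Suc n) a j)
          = (\<Sum>x\<in>X. of_bool (0 < K x a)) + (\<Sum>x\<in>X. of_bool (0 < K x (partner a j)))
            + step_avg d (\<lambda>s. \<Sum>x\<in>X. occupation (K x) n (\<lambda>i. a i + s i) (j + c s))"
        using False by (simp add: sum.distrib step_avg_sum)
      also have "\<dots> \<le> real k + real k
          + step_avg d (\<lambda>s. 2 * real k * (M * \<Theta> (\<lambda>i. a i + s i) (j + c s) + ?T (j + c s)))"
      proof (intro add_mono visits step_avg_mono)
        fix s assume "s \<in> unit_steps d"
        then show "(\<Sum>x\<in>X. occupation (K x) n (\<lambda>i. a i + s i) (j + c s))
            \<le> 2 * real k * (M * \<Theta> (\<lambda>i. a i + s i) (j + c s) + ?T (j + c s))"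
          using c_range[of s] False by (intro Suc.IH) auto
      qed
      also have "\<dots> = 2 * real k * (1 + M * step_avg d (\<lambda>s. \<Theta> (\<lambda>i. a i + s i) (j + c s))
          + step_avg d (\<lambda>s. ?T (j + c s)))"
        unfolding step_avg_cmult step_avg_add by (simp add: algebra_simps)
      also have "\<dots> \<le> 2 * real k * (1 + M * \<Theta> a j + (?T j - 1))"
        using \<Theta>_super[of j a] False M
        by (intro mult_left_mono add_mono Tavg) auto
      finally show ?thesis by simp
    qed
  qed
qed

end

section \<open>Variance of functionals of the range\<close>

text \<open>
  A supersolution for the probability that, before merging, the distance of the two reflected
  walks or the displacement of one of them reaches the order of \<rho>.
\<close>

definition escape_potential ::
  "nat \<Rightarrow> nat \<Rightarrow> nat \<Rightarrow> (nat \<Rightarrow> int) \<Rightarrow> (nat \<Rightarrow> int) \<Rightarrow> int \<Rightarrow> real" where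
  "escape_potential d N \<rho> a0 a j =
     (if int \<rho> \<le> j then 1
      else min 1 (real_of_int j / real \<rho>
        + (torus_norm_sq d N (\<lambda>i. a i - a0 i)
           + real d * (real_of_int j * (real \<rho> - real_of_int j))) / (real \<rho>)\<^sup>2))"

text \<open>The term j/\<rho> is the gambler's ruin probability that j reaches \<rho> before 0. In
  the other term the growth of the squared displacement, at most 1 in mean, is paid for by d j
  (\<rho> - j), which drops by at least 1; dividing by the square of \<rho> is Markov's inequality.
  Truncation at 1 keeps the inequality.\<close>

lemma (in reflected_steps) escape_potential_superharmonic:
  assumes \<rho>: "0 < \<rho>" and j: "0 < j"
  shows "step_avg d (\<lambda>s. escape_potential d N \<rho> a0 (\<lambda>i. a i + s i) (j + c s))
    \<le> escape_potential d N \<rho> a0 a j"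
proof -
  let ?Q = "\<lambda>a. torus_norm_sq d N (\<lambda>i. a i - a0 i)" and ?r = "real \<rho>"
  let ?f = "\<lambda>a j. real_of_int j / ?r + (?Q a + real d * (real_of_int j * (?r - real_of_int j))) / ?r\<^sup>2"
  have le1: "escape_potential d N \<rho> a0 b k \<le> 1" for b k
    by (simp add: escape_potential_def)
  show ?thesis
  proof (cases "escape_potential d N \<rho> a0 a j < 1")
    case False
    have "step_avg d (\<lambda>s. escape_potential d N \<rho> a0 (\<lambda>i. a i + s i) (j + c s)) \<le> step_avg d (\<lambda>s. 1)"
      by (intro step_avg_mono le1)
    then show ?thesis using False d_pos by simp
  next
    case True
    then have j\<rho>: "j < int \<rho>" and eq: "escape_potential d N \<rho> a0 a j = ?f a j"
      by (auto simp: escape_potential_def split: if_splits)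
    have "escape_potential d N \<rho> a0 (\<lambda>i. a i + s i) (j + c s)
        \<le> ?f (\<lambda>i. a i + s i) (j + c s)" if s: "s \<in> unit_steps d" for s
    proof (cases "int \<rho> \<le> j + c s")
      case True
      \<comment> \<open>Steps of j have size at most 1, so \<rho> is reached exactly. There j/\<rho>
        = 1 and the product j (\<rho> - j) vanishes, so the untruncated formula still dominates the
        value 1.\<close>
      then have "j + c s = int \<rho>" using c_range[OF s] j\<rho> by auto
      then have "?f (\<lambda>i. a i + s i) (j + c s) \<ge> 1"
        using \<rho> torus_norm_sq_nonneg[of d N] by (simp del: of_int_add)
      then show ?thesis using le1[of "\<lambda>i. a i + s i" "j + c s"] by linarith
    qed (simp add: escape_potential_def)
    then have "step_avg d (\<lambda>s. escape_potential d N \<rho> a0 (\<lambda>i. a i + s i) (j + c s))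
        \<le> step_avg d (\<lambda>s. ?f (\<lambda>i. a i + s i) (j + c s))"
      by (rule step_avg_mono)
    also have "\<dots> = step_avg d (\<lambda>s. ?f a j - ?Q a / ?r\<^sup>2
        + (1 / ?r\<^sup>2) * ?Q (\<lambda>i. a i + s i)
        + (1 / ?r + real d * (?r - 2 * real_of_int j) / ?r\<^sup>2) * real_of_int (c s)
        - (real d / ?r\<^sup>2) * (real_of_int (c s))\<^sup>2)"
      by (rule step_avg_cong) (use \<rho> in \<open>simp add: field_simps power2_eq_square\<close>)
    also have "\<dots> = ?f a j - ?Q a / ?r\<^sup>2 + (1 / ?r\<^sup>2) * step_avg d (\<lambda>s. ?Q (\<lambda>i. a i + s i))
        - (real d / ?r\<^sup>2) * step_avg d (\<lambda>s. (real_of_int (c s))\<^sup>2)"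
      unfolding step_avg_add step_avg_diff step_avg_cmult c_mean using d_pos by simp
    also have "\<dots> \<le> ?f a j - ?Q a / ?r\<^sup>2 + (1 / ?r\<^sup>2) * (?Q a + 1) - (real d / ?r\<^sup>2) * (1 / real d)"
    proof (intro diff_mono add_left_mono mult_left_mono)
      show "step_avg d (\<lambda>s. ?Q (\<lambda>i. a i + s i)) \<le> ?Q a + 1"
        using step_avg_torus_norm_sq_le[OF d_pos N_pos, of "\<lambda>i. a i - a0 i"]
        by (simp add: algebra_simps)
    qed (use c_second_moment in auto)
    also have "\<dots> = ?f a j" using d_pos by (simp add: add_divide_distrib)
    finally show ?thesis using eq by simp
  qed
qed

text \<open>The height is twice d L^2, the largest squared Euclidean distance from x within its box.
  So the function is at least d L^2 on the box, while its support still has diameter of order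
  L.\<close>

definition tent :: "nat \<Rightarrow> nat \<Rightarrow> nat \<Rightarrow> (nat \<Rightarrow> int) \<Rightarrow> (nat \<Rightarrow> int) \<Rightarrow> real" where
  "tent d N L x z = max 0 (2 * real d * (real L)\<^sup>2 - torus_norm_sq d N (\<lambda>i. z i - x i))"

lemma tent_nonneg: "0 \<le> tent d N L x z"
  by (simp add: tent_def)

lemma tent_le: "tent d N L x z \<le> 2 * real d * (real L)\<^sup>2"
  using torus_norm_sq_nonneg[of d N "\<lambda>i. z i - x i"] by (simp add: tent_def)

lemma tent_subharmonic:
  assumes "0 < d" "0 < N"
  shows "tent d N L x z \<le> step_avg d (\<lambda>s. tent d N L x (\<lambda>i. z i + s i)) + of_bool (0 < tent d N L x z)"
proof (cases "0 < tent d N L x z")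
  case True
  let ?Q = "\<lambda>z. torus_norm_sq d N (\<lambda>i. z i - x i)" and ?h = "2 * real d * (real L)\<^sup>2"
  have "tent d N L x z - 1 = ?h - (?Q z + 1)" using True by (simp add: tent_def)
  also have "\<dots> \<le> ?h - step_avg d (\<lambda>s. ?Q (\<lambda>i. z i + s i))"
    using step_avg_torus_norm_sq_le[OF assms, of "\<lambda>i. z i - x i"] by (simp add: algebra_simps)
  also have "\<dots> = step_avg d (\<lambda>s. ?h - ?Q (\<lambda>i. z i + s i))"
    using assms(1) by (simp add: step_avg_diff)
  also have "\<dots> \<le> step_avg d (\<lambda>s. tent d N L x (\<lambda>i. z i + s i))"
    by (intro step_avg_mono) (simp add: tent_def)
  finally show ?thesis using True by simp
next
  case False
  then have "tent d N L x z = 0" using tent_nonneg[of d N L x z] by simp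
  moreover have "step_avg d (\<lambda>s. 0) \<le> step_avg d (\<lambda>s. tent d N L x (\<lambda>i. z i + s i))"
    by (intro step_avg_mono tent_nonneg)
  ultimately show ?thesis using assms(1) by simp
qed

lemma tent_pos_imp_near:
  assumes "0 < N" "0 < tent d N L x z" "i < d"
  shows "circle_norm N (z i - x i) \<le> int (2 * d * L)"
proof -
  have "(real_of_int (circle_norm N (z i - x i)))\<^sup>2 \<le> torus_norm_sq d N (\<lambda>i. z i - x i)"
    using circle_norm_le_torus_norm_sq[OF assms(3), of N "\<lambda>i. z i - x i"] by simp
  also have "\<dots> \<le> 2 * real d * (real L)\<^sup>2" using assms(2) by (simp add: tent_def)
  \<comment> \<open>The natural radius is L sqrt (2 d); the integer 2 d L is a cruder bound for
    it.\<close>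
  also have "\<dots> \<le> (2 * real d * real L)\<^sup>2"
  proof -
    have "(2 * real d) * 1 \<le> (2 * real d) * (2 * real d)"
      using assms(3) by (intro mult_left_mono) auto
    then have "2 * real d * (real L)\<^sup>2 \<le> (2 * real d) * (2 * real d) * (real L)\<^sup>2"
      by (intro mult_right_mono) auto
    then show ?thesis by (simp add: power2_eq_square algebra_simps)
  qed
  finally have "real_of_int (circle_norm N (z i - x i)) \<le> 2 * real d * real L"
    by (rule power2_le_imp_le) simp
  then have "real_of_int (circle_norm N (z i - x i)) \<le> real_of_int (int (2 * d * L))" by simp
  then show ?thesis by (simp only: of_int_le_iff)
qed

lemma card_tent_pos_le:
  assumes "0 < N" "X \<subseteq> torus d N"
  shows "card {x \<in> X. 0 < tent d N L x z} \<le> (4 * d * L + 1) ^ d"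
proof -
  have fin: "finite (torus d N)" unfolding torus_def by (intro finite_PiE) auto
  have "card {x \<in> X. 0 < tent d N L x z}
      \<le> card {x \<in> torus d N. \<forall>i<d. circle_norm N (z i - x i) \<le> int (2 * d * L)}"
    using assms tent_pos_imp_near fin by (intro card_mono) auto
  also have "\<dots> \<le> (2 * (2 * d * L) + 1) ^ d" by (rule card_torus_box_le)
  finally show ?thesis by (simp add: mult.assoc)
qed

text \<open>
  The walk needs of the order of L squared steps to cross a box, so walks from neighbouring points
  at distance of order L from a box differ near it with probability of order 1/L only; this
  is why the sites x within distance of order L of y are excluded.
\<close>

lemma sum_far_influence_le:
  assumes d: "0 < d" and N: "0 < N" and L: "1 \<le> L" "L \<le> N"
    and e: "e \<in> unit_steps d" and e': "e' \<in> unit_steps d"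
    and F: "\<And>x A. 0 \<le> F x A" "\<And>x A. F x A \<le> 1"
    and F_off: "\<And>x a A. x \<in> X \<Longrightarrow> real d * (real L)\<^sup>2 < torus_norm_sq d N (\<lambda>i. a i - x i)
      \<Longrightarrow> F x (insert (torus_proj d N a) A) = F x A"
    and X: "X \<subseteq> torus d N"
    and far: "\<And>x. x \<in> X \<Longrightarrow> \<exists>i<d. int ((2 * d + 4) * L) < circle_norm N (y i - x i)"
    and y: "y \<in> torus d N"
  shows "(\<Sum>x\<in>X. \<bar>range_mean d N n (F x) A (torus_add d N y e)
        - range_mean d N n (F x) A (torus_add d N y e')\<bar>)
    \<le> 2 * (5 * real d) ^ d * (2 * real d + 3) * (real L ^ d * real N / (real L)\<^sup>2)"
proof (cases "e = e'")
  case True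
  then show ?thesis by simp
next
  case False
  define D where "D = (\<lambda>i. e i - e' i)"
  obtain c r where "reflected_steps d N D c r"
    using reflected_steps_exist[OF d N e e' False] unfolding D_def .
  then interpret reflected_steps d N D c r .
  let ?K = "tent d N L" and ?\<kappa> = "real d * (real L)\<^sup>2" and ?l = "real L"
  define a0 where "a0 = (\<lambda>i. y i + e i)"
  let ?\<Theta> = "escape_potential d N L a0" and ?k = "(4 * d * L + 1) ^ d"
  have \<kappa>: "0 < ?\<kappa>" using d L by simp
  have finX: "finite X"
    using X by (rule finite_subset) (auto simp: torus_def intro!: finite_PiE)
  have start: "torus_add d N y e = torus_proj d N a0"
    "torus_add d N y e' = torus_proj d N (partner a0 1)"
    using torus_add_proj[of d N y] torus_proj_id[OF y] by (simp_all add: a0_def D_def)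
  \<comment> \<open>Origin of the constant (2 d + 4) L: the support of the tent takes 2 d L, the
    displacement of the first walk L, the separation j D with j < L and entries of D at most 2 takes
    2 L, and the initial step takes 1, which is at most L.\<close>
  have confined: "?K x a = 0 \<and> ?K x (partner a j) = 0"
    if j: "0 \<le> j" and lt: "?\<Theta> a j < 1" and x: "x \<in> X" for a j x
  proof -
    have jL: "j < int L" using lt by (simp add: escape_potential_def split: if_splits)
    have "real_of_int j / ?l + (torus_norm_sq d N (\<lambda>i. a i - a0 i)
        + real d * (real_of_int j * (?l - real_of_int j))) / ?l\<^sup>2 < 1"
      using lt jL by (simp add: escape_potential_def split: if_splits)
    moreover have "0 \<le> real_of_int j / ?l" using j by simp
    moreover have "0 \<le> real d * (real_of_int j * (?l - real_of_int j)) / ?l\<^sup>2"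
      using j jL by simp
    ultimately have "torus_norm_sq d N (\<lambda>i. a i - a0 i) / ?l\<^sup>2 < 1"
      by (simp add: add_divide_distrib)
    then have Q: "torus_norm_sq d N (\<lambda>i. a i - a0 i) < ?l\<^sup>2" using L by (simp add: field_simps)
    have near: "circle_norm N (a i - a0 i) \<le> int L" if "i < d" for i
    proof -
      have "(real_of_int (circle_norm N (a i - a0 i)))\<^sup>2 \<le> ?l\<^sup>2"
        using circle_norm_le_torus_norm_sq[OF that, of N "\<lambda>i. a i - a0 i"] Q by simp
      then have "real_of_int (circle_norm N (a i - a0 i)) \<le> ?l" by (rule power2_le_imp_le) simp
      then show ?thesis by simp
    qed
    obtain i where i: "i < d" and fi: "int ((2 * d + 4) * L) < circle_norm N (y i - x i)"
      using far[OF x] by blast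
    have e1: "circle_norm N (- e i) \<le> 1"
      using circle_norm_le_abs[OF N, of "- e i"] abs_unit_step_le[OF e, of i] by simp
    have "circle_norm N (y i - x i) \<le> circle_norm N (a0 i - x i) + 1"
      using circle_norm_triangle[OF N, of "a0 i - x i" "- e i"] e1 by (simp add: a0_def algebra_simps)
    moreover have "circle_norm N (a0 i - x i) \<le> circle_norm N (a i - x i) + circle_norm N (a i - a0 i)"
      using circle_norm_triangle[OF N, of "a i - x i" "a0 i - a i"] circle_norm_minus[of N "a i - a0 i"]
      by simp
    ultimately have "circle_norm N (y i - x i) \<le> circle_norm N (a i - x i) + circle_norm N (a i - a0 i) + 1"
      by linarith
    with fi near[OF i] L have ax: "int (2 * d * L) + 2 * int L < circle_norm N (a i - x i)"
      by (simp add: algebra_simps)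
    have "circle_norm N (j * D i) \<le> \<bar>j * D i\<bar>" by (rule circle_norm_le_abs[OF N])
    also have "\<dots> \<le> int L * 2"
      unfolding abs_mult using D_bound[of i] j jL by (intro mult_mono) auto
    finally have jD: "circle_norm N (j * D i) \<le> 2 * int L" by simp
    have "circle_norm N (a i - x i) \<le> circle_norm N (partner a j i - x i) + circle_norm N (j * D i)"
      using circle_norm_triangle[OF N, of "partner a j i - x i" "j * D i"] by (simp add: algebra_simps)
    with ax jD have px: "int (2 * d * L) < circle_norm N (partner a j i - x i)" by linarith
    have "\<not> 0 < ?K x a" using tent_pos_imp_near[OF N _ i, of L x a] ax by force
    moreover have "\<not> 0 < ?K x (partner a j)"
      using tent_pos_imp_near[OF N _ i, of L x "partner a j"] px by force
    ultimately show ?thesis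
      using tent_nonneg[of d N L x a] tent_nonneg[of d N L x "partner a j"] by simp
  qed
  have \<Theta>_nonneg: "0 \<le> ?\<Theta> a j" if "0 \<le> j" for a j
    using that torus_norm_sq_nonneg[of d N "\<lambda>i. a i - a0 i"] by (simp add: escape_potential_def)
  have "(\<Sum>x\<in>X. \<bar>range_mean d N n (F x) A (torus_add d N y e)
        - range_mean d N n (F x) A (torus_add d N y e')\<bar>) \<le> (\<Sum>x\<in>X. occupation (?K x) n a0 1 / ?\<kappa>)"
    unfolding start
  proof (rule sum_mono)
    fix x assume x: "x \<in> X"
    show "\<bar>range_mean d N n (F x) A (torus_proj d N a0)
        - range_mean d N n (F x) A (torus_proj d N (partner a0 1))\<bar> \<le> occupation (?K x) n a0 1 / ?\<kappa>"
    proof (rule range_mean_partner_diff_le[OF F \<kappa> _ tent_nonneg tent_subharmonic[OF d N]])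
      show "F x (insert (torus_proj d N a) A) = F x A" if "?K x a < ?\<kappa>" for a A
        using that by (intro F_off[OF x]) (simp add: tent_def)
    qed (use N in auto)
  qed
  also have "\<dots> = (\<Sum>x\<in>X. occupation (?K x) n a0 1) / ?\<kappa>" by (simp add: sum_divide_distrib)
  also have "\<dots> \<le> (2 * real ?k * (2 * real d * ?l\<^sup>2 * ?\<Theta> a0 1
      + real d * (real_of_int 1 * (real N - real_of_int 1)))) / ?\<kappa>"
  proof (rule divide_right_mono, rule sum_occupation_le[where \<Theta> = ?\<Theta>,
        OF finX tent_nonneg tent_le card_tent_pos_le[OF N X]])
    show "0 \<le> ?\<Theta> a j" if "0 \<le> j" for a j using that by (rule \<Theta>_nonneg)
    show "step_avg d (\<lambda>s. ?\<Theta> (\<lambda>i. a i + s i) (j + c s)) \<le> ?\<Theta> a j" if "0 < j" for a j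
      using L by (intro escape_potential_superharmonic that) simp
    show "?K x a = 0 \<and> ?K x (partner a j) = 0" if "0 \<le> j" "?\<Theta> a j < 1" "x \<in> X" for a j x
      using that by (rule confined)
  qed (use N \<kappa> in auto)
  \<comment> \<open>Here 4 d L + 1 is at most 5 d L, and the potential at the start is at most 1/L +
    d/L. Multiplied by the height 2 d L^2 it gives a boundary term of order L, absorbed into N
    below.\<close>
  also have "\<dots> \<le> (2 * ((5 * real d) ^ d * ?l ^ d) * (2 * real d * ?l\<^sup>2 * ((1 + real d) / ?l)
      + real d * real N)) / ?\<kappa>"
  proof (intro divide_right_mono mult_mono add_mono mult_left_mono)
    have "4 * d * L + 1 \<le> 5 * d * L" using d L by (simp add: Suc_le_eq)
    then have "?k \<le> (5 * d * L) ^ d" by (rule power_mono) simp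
    then have "real ?k \<le> real ((5 * d * L) ^ d)" by (simp only: of_nat_le_iff)
    then show "real ?k \<le> (5 * real d) ^ d * ?l ^ d" by (simp add: power_mult_distrib)
    show "?\<Theta> a0 1 \<le> (1 + real d) / ?l"
    \<comment> \<open>For L = 1 the start j = 1 is already at the threshold, where the potential
      equals 1 by its first clause.\<close>
    proof (cases "L = 1")
      case True
      then show ?thesis by (simp add: escape_potential_def)
    next
      case False
      have "torus_norm_sq d N (\<lambda>i. a0 i - a0 i) = 0"
        using N by (simp add: torus_norm_sq_def circle_norm_def)
      then have "?\<Theta> a0 1 \<le> 1 / ?l + (real d * (?l - 1)) / ?l\<^sup>2"
        using False L by (simp add: escape_potential_def)
      also have "\<dots> \<le> 1 / ?l + (real d * ?l) / ?l\<^sup>2"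
        by (intro add_left_mono divide_right_mono mult_left_mono) auto
      also have "\<dots> = (1 + real d) / ?l" using L by (simp add: field_simps power2_eq_square)
      finally show ?thesis .
    qed
    show "0 \<le> 2 * real d * ?l\<^sup>2 * ?\<Theta> a0 1 + real d * (real_of_int 1 * (real N - real_of_int 1))"
      using N \<Theta>_nonneg[of 1 a0] by simp
  qed (use N \<kappa> \<Theta>_nonneg[of 1 a0] in auto)
  also have "\<dots> = 2 * (5 * real d) ^ d * ?l ^ d * ((2 * (1 + real d) * ?l + real N) / ?l\<^sup>2)"
    using d L by (simp add: field_simps power2_eq_square)
  also have "\<dots> \<le> 2 * (5 * real d) ^ d * ?l ^ d * (((2 * real d + 3) * real N) / ?l\<^sup>2)"
  proof (intro mult_left_mono divide_right_mono)
    have "2 * (1 + real d) * ?l \<le> 2 * (1 + real d) * real N"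
      using L by (intro mult_left_mono) auto
    then show "2 * (1 + real d) * ?l + real N \<le> (2 * real d + 3) * real N"
      by (simp add: algebra_simps)
  qed auto
  finally show ?thesis by (simp add: algebra_simps add_divide_distrib)
qed

section \<open>Decomposition of the variance along the walk\<close>

definition range_var :: "nat \<Rightarrow> nat \<Rightarrow> nat \<Rightarrow> ((nat \<Rightarrow> int) set \<Rightarrow> real) \<Rightarrow>
    (nat \<Rightarrow> int) set \<Rightarrow> (nat \<Rightarrow> int) \<Rightarrow> real" where
  "range_var d N n F A y = range_mean d N n (\<lambda>B. (F B)\<^sup>2) A y - (range_mean d N n F A y)\<^sup>2"

text \<open>Law of total variance for the next step; unrolled, it is the sum of the variances of the
  martingale increments.\<close>

lemma range_var_Suc:
  "range_var d N (Suc n) F A y =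
     step_avg d (\<lambda>s. range_var d N n F (insert y A) (torus_add d N y s))
     + step_var d (\<lambda>s. range_mean d N n F (insert y A) (torus_add d N y s))"
  by (simp add: range_var_def step_var_def step_avg_diff)

lemma range_var_le_one:
  assumes "0 < d" "\<And>A. 0 \<le> F A" "\<And>A. F A \<le> 1"
  shows "range_var d N n F A y \<le> 1"
proof -
  have "range_mean d N n (\<lambda>B. (F B)\<^sup>2) A y \<le> range_mean d N n (\<lambda>B. 1) A y"
    using assms by (intro range_mean_mono) (simp add: power_le_one)
  then have "range_mean d N n (\<lambda>B. (F B)\<^sup>2) A y \<le> 1" using assms(1) by (simp add: range_mean_const)
  then show ?thesis
    unfolding range_var_def using zero_le_power2[of "range_mean d N n F A y"] by linarith
qed

lemma torus_add_in_torus: "0 < N \<Longrightarrow> torus_add d N y s \<in> torus d N"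
  by (auto simp: torus_add_def torus_def)

text \<open>The set of near sites moves with the walk. Their one-step variances are enlarged to a
  sum over all of X, because then they recombine, site by site, with the remaining variances into
  the total variance of each \<open>F x\<close>: near sites are paid for once and not at every step.
  Far sites cost the squared oscillation at each of the n steps.\<close>

lemma range_var_weighted_sum_le:
  fixes F :: "(nat \<Rightarrow> int) \<Rightarrow> (nat \<Rightarrow> int) set \<Rightarrow> real"
  assumes d: "0 < d" and N: "0 < N" and X: "finite X"
    and near: "\<And>y. y \<in> torus d N \<Longrightarrow> card (near y) \<le> k" "\<And>y. near y \<subseteq> X"
    and far: "\<And>y n A e e'. y \<in> torus d N \<Longrightarrow> e \<in> unit_steps d \<Longrightarrow> e' \<in> unit_steps d \<Longrightarrow>
      (\<Sum>x\<in>X - near y. \<bar>range_mean d N n (F x) A (torus_add d N y e)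
        - range_mean d N n (F x) A (torus_add d N y e')\<bar>) \<le> \<delta>"
    and y: "y \<in> torus d N"
  shows "range_var d N n (\<lambda>A. w * (\<Sum>x\<in>X. F x A)) A y
    \<le> 2 * w\<^sup>2 * real k * (\<Sum>x\<in>X. range_var d N n (F x) A y) + 2 * real n * (w * \<delta>)\<^sup>2"
  using y
proof (induction n arbitrary: A y)
  case 0
  show ?case by (simp add: range_var_def)
next
  case (Suc n)
  let ?G = "\<lambda>A. w * (\<Sum>x\<in>X. F x A)"
  let ?A = "insert y A" and ?y = "torus_add d N y"
  define m where "m x s = range_mean d N n (F x) ?A (?y s)" for x s
  define V where "V x = step_avg d (\<lambda>s. range_var d N n (F x) ?A (?y s))" for x
  have split: "(\<Sum>x\<in>X. g x) = (\<Sum>x\<in>near y. g x) + (\<Sum>x\<in>X - near y. g x)" for g :: "_ \<Rightarrow> real"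
    using sum.subset_diff[OF near(2) X, of g y] by simp
  have "step_var d (\<lambda>s. range_mean d N n ?G ?A (?y s))
      = step_var d (\<lambda>s. w * (\<Sum>x\<in>X. m x s))"
    by (simp add: range_mean_cmult range_mean_sum m_def)
  also have "\<dots> = w\<^sup>2 * step_var d (\<lambda>s. (\<Sum>x\<in>near y. m x s) + (\<Sum>x\<in>X - near y. m x s))"
    by (simp add: step_var_cmult split)
  also have "\<dots> \<le> w\<^sup>2 * (2 * step_var d (\<lambda>s. \<Sum>x\<in>near y. m x s)
      + 2 * step_var d (\<lambda>s. \<Sum>x\<in>X - near y. m x s))"
    by (intro mult_left_mono step_var_add_le d) simp
  also have "\<dots> \<le> w\<^sup>2 * (2 * (real k * (\<Sum>x\<in>X. step_var d (m x))) + 2 * \<delta>\<^sup>2)"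
  proof (intro mult_left_mono add_mono)
    have "step_var d (\<lambda>s. \<Sum>x\<in>near y. m x s) \<le> real (card (near y)) * (\<Sum>x\<in>near y. step_var d (m x))"
      by (rule step_var_sum_le[OF d])
    also have "\<dots> \<le> real k * (\<Sum>x\<in>X. step_var d (m x))"
      using near Suc.prems X step_var_nonneg[OF d]
      by (intro mult_mono sum_mono2 sum_nonneg) auto
    finally show "step_var d (\<lambda>s. \<Sum>x\<in>near y. m x s) \<le> real k * (\<Sum>x\<in>X. step_var d (m x))" .
    show "step_var d (\<lambda>s. \<Sum>x\<in>X - near y. m x s) \<le> \<delta>\<^sup>2"
    proof (rule step_var_le_osc[OF d])
      fix e e' assume e: "e \<in> unit_steps d" and e': "e' \<in> unit_steps d"
      have "\<bar>(\<Sum>x\<in>X - near y. m x e) - (\<Sum>x\<in>X - near y. m x e')\<bar> \<le> (\<Sum>x\<in>X - near y. \<bar>m x e - m x e'\<bar>)"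
        unfolding sum_subtractf[symmetric] by (rule sum_abs)
      also have "\<dots> \<le> \<delta>" unfolding m_def by (rule far[OF Suc.prems e e'])
      finally show "\<bar>(\<Sum>x\<in>X - near y. m x e) - (\<Sum>x\<in>X - near y. m x e')\<bar> \<le> \<delta>" .
    qed
  qed auto
  finally have var: "step_var d (\<lambda>s. range_mean d N n ?G ?A (?y s))
      \<le> 2 * w\<^sup>2 * real k * (\<Sum>x\<in>X. step_var d (m x)) + 2 * (w * \<delta>)\<^sup>2"
    by (simp add: algebra_simps power_mult_distrib)
  have "step_avg d (\<lambda>s. range_var d N n ?G ?A (?y s))
      \<le> step_avg d (\<lambda>s. 2 * w\<^sup>2 * real k * (\<Sum>x\<in>X. range_var d N n (F x) ?A (?y s))
          + 2 * real n * (w * \<delta>)\<^sup>2)"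
    by (intro step_avg_mono Suc.IH torus_add_in_torus N)
  also have "\<dots> = 2 * w\<^sup>2 * real k * (\<Sum>x\<in>X. V x) + 2 * real n * (w * \<delta>)\<^sup>2"
    unfolding step_avg_add step_avg_cmult step_avg_sum V_def using d by simp
  finally have "range_var d N (Suc n) ?G A y
      \<le> 2 * w\<^sup>2 * real k * ((\<Sum>x\<in>X. V x) + (\<Sum>x\<in>X. step_var d (m x)))
        + 2 * (real n + 1) * (w * \<delta>)\<^sup>2"
    unfolding range_var_Suc using var by (simp add: algebra_simps)
  also have "(\<Sum>x\<in>X. V x) + (\<Sum>x\<in>X. step_var d (m x)) = (\<Sum>x\<in>X. range_var d N (Suc n) (F x) A y)"
    unfolding range_var_Suc sum.distrib[symmetric] V_def m_def ..
  finally show ?case by (simp add: algebra_simps)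
qed

section \<open>Spatial averages of the trace\<close>

lemma circle_norm_mod [simp]: "circle_norm N (k mod int N) = circle_norm N k"
  using circle_norm_add_multiple[of N k "- (k div int N)"]
  by (simp add: minus_div_mult_eq_mod[symmetric])

lemma circle_norm_cong: "k mod int N = l mod int N \<Longrightarrow> circle_norm N k = circle_norm N l"
  by (metis circle_norm_mod)

lemma torus_dist_le_iff:
  "0 < d \<Longrightarrow> torus_dist d N x y \<le> k \<longleftrightarrow> (\<forall>i<d. circle_norm N (x i - y i) \<le> k)"
  unfolding torus_dist_def by (subst Max_le_iff) (auto simp: circle_dist_eq)

lemma torus_diff_in_ball:
  assumes "0 < d" "0 < N" "y \<in> torus_ball d N x L"
  shows "torus_diff d N y x \<in> torus_ball d N (torus_zero d) L"
proof -
  have "circle_norm N (torus_zero d i - torus_diff d N y x i) = circle_norm N (x i - y i)"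
    if "i < d" for i
    using that circle_norm_minus[of N "(y i - x i) mod int N"] circle_norm_minus[of N "x i - y i"]
    by (simp add: torus_zero_def torus_diff_def)
  moreover have "torus_diff d N y x \<in> torus d N"
    using assms(2) by (auto simp: torus_diff_def torus_def)
  ultimately show ?thesis
    using assms by (simp add: torus_ball_def torus_dist_le_iff)
qed

lemma finite_torus [simp]: "finite (torus d N)"
  unfolding torus_def by (intro finite_PiE) auto

lemma card_torus: "card (torus d N) = N ^ d"
  by (simp add: torus_def card_PiE)

definition trace_value :: "nat \<Rightarrow> nat \<Rightarrow> nat \<Rightarrow> ((nat \<Rightarrow> int) set \<Rightarrow> real) \<Rightarrow> (nat \<Rightarrow> int) \<Rightarrow>
    (nat \<Rightarrow> int) set \<Rightarrow> real" where
  "trace_value d N L \<phi> x A = \<phi> ((\<lambda>y. torus_diff d N y x) ` (A \<inter> torus_ball d N x L))"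

definition trace_avg :: "nat \<Rightarrow> nat \<Rightarrow> nat \<Rightarrow> ((nat \<Rightarrow> int) set \<Rightarrow> real) \<Rightarrow> (nat \<Rightarrow> int) set \<Rightarrow> real" where
  "trace_avg d N L \<phi> A = 1 / real N ^ d * (\<Sum>x\<in>torus d N. trace_value d N L \<phi> x A)"

lemma Gamma_avg_eq: "Gamma_avg d N L \<phi> u \<omega> = trace_avg d N L \<phi> (walk_range d N (u * real N ^ d) \<omega>)"
  by (simp add: Gamma_avg_def trace_avg_def local_value_def trace_value_def)

lemma trace_in_ball:
  "0 < d \<Longrightarrow> 0 < N \<Longrightarrow> (\<lambda>y. torus_diff d N y x) ` (A \<inter> torus_ball d N x L) \<in> Pow (torus_ball d N (torus_zero d) L)"
  using torus_diff_in_ball by blast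

lemma trace_value_bounds:
  assumes "0 < d" "0 < N" "\<phi> \<in> Pow (torus_ball d N (torus_zero d) L) \<rightarrow> {0..1}"
  shows "0 \<le> trace_value d N L \<phi> x A" "trace_value d N L \<phi> x A \<le> 1"
  using funcset_mem[OF assms(3) trace_in_ball[OF assms(1,2)]] by (auto simp: trace_value_def)

lemma trace_avg_bounds:
  assumes "0 < d" "0 < N" "\<phi> \<in> Pow (torus_ball d N (torus_zero d) L) \<rightarrow> {0..1}"
  shows "0 \<le> trace_avg d N L \<phi> A" "trace_avg d N L \<phi> A \<le> 1"
proof -
  have "(\<Sum>x\<in>torus d N. trace_value d N L \<phi> x A) \<le> (\<Sum>x\<in>torus d N. 1)"
    by (intro sum_mono trace_value_bounds assms)
  then show "trace_avg d N L \<phi> A \<le> 1"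
    using assms(2) by (simp add: trace_avg_def card_torus divide_le_eq)
  show "0 \<le> trace_avg d N L \<phi> A"
    unfolding trace_avg_def using trace_value_bounds(1)[OF assms] by (simp add: sum_nonneg)
qed

lemma trace_avg_antimono:
  assumes "0 < d" "0 < N" "antimono_on (Pow (torus_ball d N (torus_zero d) L)) \<phi>" "A \<subseteq> B"
  shows "trace_avg d N L \<phi> B \<le> trace_avg d N L \<phi> A"
  unfolding trace_avg_def trace_value_def
  using assms(4)
  by (intro mult_left_mono sum_mono monotone_onD[OF assms(3)] trace_in_ball assms(1,2)) auto

text \<open>Allows the range to be cut down to the torus, where it takes finitely many values, when
  measurability is needed.\<close>

lemma trace_avg_inter_torus: "trace_avg d N L \<phi> (A \<inter> torus d N) = trace_avg d N L \<phi> A"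
proof -
  have "A \<inter> torus d N \<inter> torus_ball d N x L = A \<inter> torus_ball d N x L" for x
    by (auto simp: torus_ball_def)
  then show ?thesis by (simp add: trace_avg_def trace_value_def)
qed

lemma trace_value_insert_far:
  assumes "0 < d" "0 < N" "real d * (real L)\<^sup>2 < torus_norm_sq d N (\<lambda>i. a i - x i)"
  shows "trace_value d N L \<phi> x (insert (torus_proj d N a) A) = trace_value d N L \<phi> x A"
proof -
  have "torus_proj d N a \<notin> torus_ball d N x L"
  proof
    assume "torus_proj d N a \<in> torus_ball d N x L"
    then have near: "circle_norm N (x i - torus_proj d N a i) \<le> int L" if "i < d" for i
      using assms(1) that by (auto simp: torus_ball_def torus_dist_le_iff)
    have "torus_norm_sq d N (\<lambda>i. a i - x i) \<le> (\<Sum>i<d. (real L)\<^sup>2)"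
      unfolding torus_norm_sq_def
    proof (rule sum_mono)
      fix i assume i: "i \<in> {..<d}"
      have "circle_norm N (x i - torus_proj d N a i) = circle_norm N (x i - a i)"
        using i by (intro circle_norm_cong) (simp add: torus_proj_def mod_diff_right_eq)
      then have "circle_norm N (a i - x i) \<le> int L"
        using near[of i] i circle_norm_minus[of N "x i - a i"] by simp
      then show "(real_of_int (circle_norm N (a i - x i)))\<^sup>2 \<le> (real L)\<^sup>2"
        using circle_norm_nonneg[OF assms(2), of "a i - x i"] by (intro power_mono) linarith+
    qed
    then show False using assms(3) by simp
  qed
  then have "insert (torus_proj d N a) A \<inter> torus_ball d N x L = A \<inter> torus_ball d N x L" by simp
  then show ?thesis by (simp add: trace_value_def)
qed

text \<open>The squared weight N^(-2d), at most ((4 d + 9) L)^d near sites and N^d total variances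
  of at most 1 give the term (L/N)^d. At most u N^d steps, each with oscillation of order N^(-d)
  L^(d-2) N, give the other.\<close>

lemma range_var_trace_avg_le:
  assumes d: "3 \<le> d" and L: "1 \<le> L" "L \<le> N"
    and \<phi>: "\<phi> \<in> Pow (torus_ball d N (torus_zero d) L) \<rightarrow> {0..1}"
    and y: "y \<in> torus d N" and n: "real n \<le> u * real N ^ d"
  shows "range_var d N n (trace_avg d N L \<phi>) A y
    \<le> (2 * real (4 * d + 9) ^ d + 2 * (2 * (5 * real d) ^ d * (2 * real d + 3))\<^sup>2)
      * ((real L / real N) ^ d + u * (real L ^ d / real N))"
proof -
  have d0: "0 < d" and N: "0 < N" using d L by auto
  let ?c = "2 * (5 * real d) ^ d * (2 * real d + 3)"
  let ?\<delta> = "?c * (real L ^ d * real N / (real L)\<^sup>2)"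
  let ?F = "trace_value d N L \<phi>" and ?w = "1 / real N ^ d"
  let ?k = "(2 * ((2 * d + 4) * L) + 1) ^ d"
  define near where "near y = {x \<in> torus d N. \<forall>i<d. circle_norm N (y i - x i) \<le> int ((2 * d + 4) * L)}" for y
  have u: "0 \<le> u"
  proof (rule ccontr)
    assume "\<not> 0 \<le> u"
    then have "u * real N ^ d < 0" using N by (intro mult_neg_pos) auto
    then show False using n by linarith
  qed
  have "range_var d N n (trace_avg d N L \<phi>) A y
      \<le> 2 * ?w\<^sup>2 * real ?k * (\<Sum>x\<in>torus d N. range_var d N n (?F x) A y) + 2 * real n * (?w * ?\<delta>)\<^sup>2"
    unfolding trace_avg_def[abs_def]
  proof (rule range_var_weighted_sum_le[OF d0 N finite_torus _ _ _ y, where near = near])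
    show "card (near z) \<le> ?k" for z
      unfolding near_def by (rule card_torus_box_le)
    show "near z \<subseteq> torus d N" for z by (auto simp: near_def)
    show "(\<Sum>x\<in>torus d N - near z. \<bar>range_mean d N n (?F x) A (torus_add d N z e)
        - range_mean d N n (?F x) A (torus_add d N z e')\<bar>) \<le> ?\<delta>"
      if "z \<in> torus d N" "e \<in> unit_steps d" "e' \<in> unit_steps d" for z n A e e'
    proof (rule sum_far_influence_le[OF d0 N L that(2,3)])
      show "\<exists>i<d. int ((2 * d + 4) * L) < circle_norm N (z i - x i)" if "x \<in> torus d N - near z" for x
        using that by (auto simp: near_def not_le)
    qed (use trace_value_bounds[OF d0 N \<phi>] trace_value_insert_far[OF d0 N] that in auto)
  qed
  also have "\<dots> \<le> 2 * ?w\<^sup>2 * (real (4 * d + 9) ^ d * real L ^ d) * real N ^ d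
      + 2 * (u * real N ^ d) * (?w * ?\<delta>)\<^sup>2"
  proof (intro add_mono mult_mono)
    have "2 * ((2 * d + 4) * L) + 1 \<le> (4 * d + 9) * L" using L by (simp add: algebra_simps)
    then have "?k \<le> ((4 * d + 9) * L) ^ d" by (rule power_mono) simp
    then have "real ?k \<le> real (((4 * d + 9) * L) ^ d)" by (simp only: of_nat_le_iff)
    then show "real ?k \<le> real (4 * d + 9) ^ d * real L ^ d" by (simp add: power_mult_distrib)
    have "(\<Sum>x\<in>torus d N. range_var d N n (?F x) A y) \<le> (\<Sum>x\<in>torus d N. 1)"
      by (intro sum_mono range_var_le_one d0 trace_value_bounds[OF d0 N \<phi>])
    then show "(\<Sum>x\<in>torus d N. range_var d N n (?F x) A y) \<le> real N ^ d" by (simp add: card_torus)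
    have "range_var d N m F B z \<ge> 0" for m F B z
    proof (induction m arbitrary: B z)
      case (Suc m)
      have "step_avg d (\<lambda>s. 0) \<le> step_avg d (\<lambda>s. range_var d N m F (insert z B) (torus_add d N z s))"
        by (intro step_avg_mono Suc.IH)
      then show ?case unfolding range_var_Suc using step_var_nonneg[OF d0] d0 by simp
    qed (simp add: range_var_def)
    then show "0 \<le> (\<Sum>x\<in>torus d N. range_var d N n (?F x) A y)" by (intro sum_nonneg)
  qed (use n u in auto)
  also have "2 * ?w\<^sup>2 * (real (4 * d + 9) ^ d * real L ^ d) * real N ^ d
      = 2 * real (4 * d + 9) ^ d * (real L / real N) ^ d"
    using N by (simp add: power2_eq_square power_divide)
  also have "2 * (u * real N ^ d) * (?w * ?\<delta>)\<^sup>2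
      = (2 * ?c\<^sup>2) * (u * ((real L ^ d * real N / (real L)\<^sup>2)\<^sup>2 / real N ^ d))"
  proof -
    have sq: "2 * (u * p) * (1 / p * (a * b))\<^sup>2 = (2 * a\<^sup>2) * (u * (b\<^sup>2 / p))" if "p \<noteq> 0" for p a b :: real
      using that by (simp add: power2_eq_square field_simps)
    show ?thesis by (rule sq) (use N in simp)
  qed
  also have "\<dots> \<le> (2 * ?c\<^sup>2) * (u * (real L ^ d / real N))"
  proof (intro mult_left_mono u)
    \<comment> \<open>The claim amounts to L^(d-4) \<le> N^(d-3). It is proved as L^e \<le> N^e L,
      which avoids the negative exponent at d = 3; this is where dimension at least 3 enters the
      estimate.\<close>
    obtain e where e: "d = e + 3" using d le_Suc_ex[of 3 d] by (auto simp: add.commute)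
    have "real L ^ e \<le> real N ^ e" using L by (intro power_mono) auto
    also have "\<dots> \<le> real N ^ e * real L" using L by simp
    finally have "real L ^ e * (real L ^ 3 * real N ^ 3 * real L ^ d)
        \<le> real N ^ e * real L * (real L ^ 3 * real N ^ 3 * real L ^ d)"
      by (rule mult_right_mono) simp
    then have "(real L ^ d)\<^sup>2 * real N ^ 3 \<le> real L ^ d * real L ^ 4 * real N ^ d"
      by (simp add: e power_add power2_eq_square eval_nat_numeral algebra_simps)
    then show "(real L ^ d * real N / (real L)\<^sup>2)\<^sup>2 / real N ^ d \<le> real L ^ d / real N"
      using L N by (simp add: field_simps power_mult_distrib power_divide eval_nat_numeral)
  qed simp
  finally have "range_var d N n (trace_avg d N L \<phi>) A y
      \<le> 2 * real (4 * d + 9) ^ d * (real L / real N) ^ d + (2 * ?c\<^sup>2) * (u * (real L ^ d / real N))"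
    by simp
  also have "\<dots> \<le> (2 * real (4 * d + 9) ^ d + 2 * ?c\<^sup>2)
      * ((real L / real N) ^ d + u * (real L ^ d / real N))"
    unfolding distrib_left using u
    by (intro add_mono mult_right_mono) auto
  finally show ?thesis .
qed

section \<open>Translation invariance\<close>

lemma torus_diff_shift:
  "torus_diff d N (torus_add d N y t) (torus_add d N x t) = torus_diff d N y x"
  unfolding torus_diff_def torus_add_def
  by (intro restrict_ext) (simp add: mod_diff_eq)

lemma torus_dist_shift:
  "torus_dist d N (torus_add d N x t) (torus_add d N y t) = torus_dist d N x y"
proof -
  have "circle_dist N (torus_add d N x t i) (torus_add d N y t i) = circle_dist N (x i) (y i)"
    if "i < d" for i
    unfolding circle_dist_eq
    using that by (intro circle_norm_cong) (simp add: torus_add_def mod_diff_eq)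
  then show ?thesis by (simp add: torus_dist_def cong: image_cong_simp)
qed

lemma torus_add_diff:
  "y \<in> torus d N \<Longrightarrow> torus_add d N x (torus_diff d N y x) = y"
  by (rule ext) (auto simp: torus_add_def torus_diff_def torus_def PiE_iff extensional_def mod_add_right_eq)

lemma torus_shift_bij:
  assumes "0 < N" shows "bij_betw (\<lambda>y. torus_add d N y t) (torus d N) (torus d N)"
proof (rule bij_betw_byWitness[where f' = "\<lambda>y. torus_add d N y (\<lambda>i. - t i)"])
  show "\<forall>y\<in>torus d N. torus_add d N (torus_add d N y t) (\<lambda>i. - t i) = y"
    "\<forall>y\<in>torus d N. torus_add d N (torus_add d N y (\<lambda>i. - t i)) t = y"
    by (auto simp: fun_eq_iff torus_add_def torus_def PiE_iff extensional_def mod_add_left_eq mod_diff_left_eq)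
qed (use assms torus_add_in_torus in auto)

lemma trace_value_shift:
  assumes "0 < N" "A \<subseteq> torus d N"
  shows "trace_value d N L \<phi> (torus_add d N x t) ((\<lambda>y. torus_add d N y t) ` A) = trace_value d N L \<phi> x A"
proof -
  have "(\<lambda>y. torus_add d N y t) ` A \<inter> torus_ball d N (torus_add d N x t) L
      = (\<lambda>y. torus_add d N y t) ` (A \<inter> torus_ball d N x L)"
    using assms torus_add_in_torus[OF assms(1)] by (auto simp: torus_ball_def torus_dist_shift)
  then show ?thesis by (simp add: trace_value_def image_image torus_diff_shift)
qed

lemma trace_avg_shift:
  assumes "0 < N" "A \<subseteq> torus d N"
  shows "trace_avg d N L \<phi> ((\<lambda>y. torus_add d N y t) ` A) = trace_avg d N L \<phi> A"
  unfolding trace_avg_def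
  by (subst sum.reindex_bij_betw[OF torus_shift_bij[OF assms(1)], where t1 = t, symmetric])
    (simp add: trace_value_shift assms)

lemma range_mean_shift:
  assumes N: "0 < N"
    and F: "\<And>A. A \<subseteq> torus d N \<Longrightarrow> F ((\<lambda>y. torus_add d N y t) ` A) = F A"
    and "A \<subseteq> torus d N" "y \<in> torus d N"
  shows "range_mean d N n F ((\<lambda>y. torus_add d N y t) ` A) (torus_add d N y t) = range_mean d N n F A y"
  using assms(3,4)
proof (induction n arbitrary: A y)
  case 0
  then show ?case using F[of "insert y A"] by simp
next
  case (Suc n)
  have comm: "torus_add d N (torus_add d N y t) s = torus_add d N (torus_add d N y s) t" for s
    unfolding torus_add_def by (intro restrict_ext) (simp add: mod_add_left_eq mod_add_right_eq algebra_simps)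
  show ?case
    using Suc.IH[of "insert y A"] Suc.prems torus_add_in_torus[OF N] by (simp add: comm)
qed

text \<open>Translation by y - x carries one start to the other. Hence the uniform starting point
  adds nothing to the variance.\<close>

lemma range_mean_trace_avg_const:
  assumes "0 < N" "x \<in> torus d N" "y \<in> torus d N"
  shows "range_mean d N n (trace_avg d N L \<phi>) {} x = range_mean d N n (trace_avg d N L \<phi>) {} y"
  using range_mean_shift[of N d "trace_avg d N L \<phi>" "torus_diff d N y x" "{}" x n] assms
  by (simp add: torus_add_diff trace_avg_shift)

section \<open>Integrals over the path space\<close>

text \<open>Projection forces finitely many values even where the start lies off the torus, so the
  next position can be treated separately for each value p of the current one.\<close>

lemma measurable_walk_proj:
  assumes N: "0 < N"
  shows "(\<lambda>\<omega>. torus_proj d N (walk d N n \<omega>)) \<in> srw_space d N \<rightarrow>\<^sub>M count_space (torus d N)"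
proof (induction n)
  case 0
  have "torus_proj d N \<in> measure_pmf (pmf_of_set (torus d N)) \<rightarrow>\<^sub>M count_space (torus d N)"
    using torus_proj_in_torus[OF N] by simp
  then show ?case unfolding srw_space_def by (simp add: measurable_compose[OF measurable_fst])
next
  case (Suc n)
  have "(\<lambda>\<omega>. torus_add d N (torus_proj d N (walk d N n \<omega>)) (snd \<omega> n))
      \<in> srw_space d N \<rightarrow>\<^sub>M count_space (torus d N)"
  proof (rule measurable_compose_countable'[OF _ Suc.IH])
    fix p
    have coord: "(\<lambda>\<omega>. snd \<omega> n) \<in> srw_space d N \<rightarrow>\<^sub>M measure_pmf (pmf_of_set (unit_steps d))"
      unfolding srw_space_def by measurable
    show "(\<lambda>\<omega>. torus_add d N p (snd \<omega> n)) \<in> srw_space d N \<rightarrow>\<^sub>M count_space (torus d N)"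
      by (rule measurable_compose[OF coord]) (simp add: torus_add_in_torus[OF N])
  qed (simp add: countable_finite)
  moreover have "torus_add d N (torus_proj d N (walk d N n \<omega>)) (snd \<omega> n)
      = torus_proj d N (walk d N (Suc n) \<omega>)" for \<omega>
    by (simp add: torus_add_proj torus_proj_id torus_add_in_torus[OF N])
      (simp add: torus_add_def torus_proj_def)
  ultimately show ?case by simp
qed

text \<open>
  Off a null set the starting point lies in the torus; intersecting with the torus makes the range
  take finitely many values everywhere, so that any function of it is measurable.
\<close>

lemma measurable_range_inter_torus:
  assumes N: "0 < N"
  shows "(\<lambda>\<omega>. (\<lambda>k. walk d N k \<omega>) ` {..n} \<inter> torus d N) \<in> srw_space d N \<rightarrow>\<^sub>M count_space (Pow (torus d N))"
proof (induction n)
  case 0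
  have "(\<lambda>x. {x} \<inter> torus d N) \<in> measure_pmf (pmf_of_set (torus d N)) \<rightarrow>\<^sub>M count_space (Pow (torus d N))"
    by simp
  from measurable_compose[OF measurable_fst this]
  have "(\<lambda>\<omega>. {fst \<omega>} \<inter> torus d N) \<in> srw_space d N \<rightarrow>\<^sub>M count_space (Pow (torus d N))"
    unfolding srw_space_def .
  then show ?case by simp
next
  case (Suc n)
  have "(\<lambda>\<omega>. insert (torus_proj d N (walk d N (Suc n) \<omega>)) ((\<lambda>k. walk d N k \<omega>) ` {..n} \<inter> torus d N))
      \<in> srw_space d N \<rightarrow>\<^sub>M count_space (Pow (torus d N))"
  proof (rule measurable_compose_countable'[OF _ Suc.IH])
    fix B assume "B \<in> Pow (torus d N)"
    then show "(\<lambda>\<omega>. insert (torus_proj d N (walk d N (Suc n) \<omega>)) B) \<in> srw_space d N \<rightarrow>\<^sub>M count_space (Pow (torus d N))"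
      by (intro measurable_compose[OF measurable_walk_proj[OF N]]) auto
  qed (simp add: countable_finite)
  moreover have "torus_proj d N (walk d N (Suc n) \<omega>) = walk d N (Suc n) \<omega>" for \<omega>
    by (simp add: torus_proj_id torus_add_in_torus[OF N])
  then have "insert (torus_proj d N (walk d N (Suc n) \<omega>)) ((\<lambda>k. walk d N k \<omega>) ` {..n} \<inter> torus d N)
      = (\<lambda>k. walk d N k \<omega>) ` {..Suc n} \<inter> torus d N" for \<omega>
    using torus_add_in_torus[OF N, of d "walk d N n \<omega>" "snd \<omega> n"] by (auto simp: atMost_Suc)
  ultimately show ?case by simp
qed

lemma borel_measurable_range:
  fixes F :: "(nat \<Rightarrow> int) set \<Rightarrow> real"
  assumes "0 < N"
  shows "(\<lambda>\<omega>. F ((\<lambda>k. walk d N k \<omega>) ` {..n} \<inter> torus d N)) \<in> borel_measurable (srw_space d N)"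
  by (rule measurable_compose[OF measurable_range_inter_torus[OF assms]]) simp

lemma walk_in_torus: "0 < N \<Longrightarrow> fst \<omega> \<in> torus d N \<Longrightarrow> walk d N n \<omega> \<in> torus d N"
  by (cases n) (auto simp: torus_add_in_torus)

lemma walk_case_nat:
  "walk d N (Suc k) (y, case_nat s \<omega>) = walk d N k (torus_add d N y s, \<omega>)"
  by (induction k) auto

abbreviation step_space :: "nat \<Rightarrow> (nat \<Rightarrow> nat \<Rightarrow> int) measure" where
  "step_space d \<equiv> \<Pi>\<^sub>M n\<in>(UNIV :: nat set). measure_pmf (pmf_of_set (unit_steps d))"

lemma borel_measurable_range_from:
  fixes F :: "(nat \<Rightarrow> int) set \<Rightarrow> real"
  assumes N: "0 < N" and y: "y \<in> torus d N"
  shows "(\<lambda>s. F (A \<union> (\<lambda>k. walk d N k (y, s)) ` {..n})) \<in> borel_measurable (step_space d)"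
proof -
  have "Pair y \<in> step_space d \<rightarrow>\<^sub>M srw_space d N"
    unfolding srw_space_def by (rule measurable_Pair1') simp
  from measurable_compose[OF this borel_measurable_range[OF N, of "\<lambda>B. F (A \<union> B)"]]
  have "(\<lambda>s. F (A \<union> ((\<lambda>k. walk d N k (y, s)) ` {..n} \<inter> torus d N))) \<in> borel_measurable (step_space d)" .
  moreover have "(\<lambda>k. walk d N k (y, s)) ` {..n} \<inter> torus d N = (\<lambda>k. walk d N k (y, s)) ` {..n}" for s
    using walk_in_torus[OF N, of "(y, s)"] y by auto
  ultimately show ?thesis by simp
qed

text \<open>A step sequence has the law of one step followed by an independent step sequence. Fubini
  then splits off the first step, which is the recursion of \<open>range_mean\<close>; A is
  arbitrary because it grows along the induction.\<close>

lemma integral_range_from: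
  fixes F :: "(nat \<Rightarrow> int) set \<Rightarrow> real"
  assumes d: "0 < d" and N: "0 < N" and F: "\<And>A. \<bar>F A\<bar> \<le> b" and y: "y \<in> torus d N"
  shows "(\<integral>s. F (A \<union> (\<lambda>k. walk d N k (y, s)) ` {..n}) \<partial>step_space d) = range_mean d N n F A y"
  using y
proof (induction n arbitrary: A y)
  interpret sequence_space "measure_pmf (pmf_of_set (unit_steps d))" ..
  {
    case 0
    have "prob_space (step_space d)" by (rule prob_space_PiM) unfold_locales
    then show ?case by (simp add: prob_space.prob_space)
  next
    case (Suc n)
    let ?M = "measure_pmf (pmf_of_set (unit_steps d))"
    let ?f = "\<lambda>s. F (A \<union> (\<lambda>k. walk d N k (y, s)) ` {..Suc n})"
    interpret P: pair_prob_space ?M "step_space d" ..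
    have f: "?f \<in> borel_measurable (step_space d)"
      by (rule borel_measurable_range_from[OF N Suc.prems])
    have cn: "(\<lambda>(s, \<omega>). case_nat s \<omega>) \<in> ?M \<Otimes>\<^sub>M step_space d \<rightarrow>\<^sub>M step_space d"
      by measurable
    have "integral\<^sup>L (step_space d) ?f
        = integral\<^sup>L (distr (?M \<Otimes>\<^sub>M step_space d) (step_space d) (\<lambda>(s, \<omega>). case_nat s \<omega>)) ?f"
      by (simp add: PiM_iter)
    also have "\<dots> = (\<integral>p. ?f ((\<lambda>(s, \<omega>). case_nat s \<omega>) p) \<partial>(?M \<Otimes>\<^sub>M step_space d))"
      by (rule integral_distr[OF cn f])
    also have "\<dots> = (\<integral>s. \<integral>\<omega>. ?f ((\<lambda>(s, \<omega>). case_nat s \<omega>) (s, \<omega>)) \<partial>step_space d \<partial>?M)"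
    proof (rule P.integral_fst'[symmetric], rule P.integrable_const_bound[of _ b])
      show "(\<lambda>p. ?f ((\<lambda>(s, \<omega>). case_nat s \<omega>) p)) \<in> borel_measurable (?M \<Otimes>\<^sub>M step_space d)"
        by (rule measurable_compose[OF cn f])
    qed (simp add: F)
    also have "\<dots> = (\<integral>s. range_mean d N n F (insert y A) (torus_add d N y s) \<partial>?M)"
    proof (rule Bochner_Integration.integral_cong[OF refl])
      fix s
      have eq: "A \<union> (\<lambda>k. walk d N k (y, case_nat s \<omega>)) ` {..Suc n}
          = insert y A \<union> (\<lambda>k. walk d N k (torus_add d N y s, \<omega>)) ` {..n}" for \<omega>
        by (simp only: atMost_Suc_eq_insert_0 image_insert image_image walk_case_nat) auto
      show "(\<integral>\<omega>. ?f ((\<lambda>(s, \<omega>). case_nat s \<omega>) (s, \<omega>)) \<partial>step_space d)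
          = range_mean d N n F (insert y A) (torus_add d N y s)"
        by (simp only: prod.case eq Suc.IH[OF torus_add_in_torus[OF N]])
    qed
    also have "\<dots> = range_mean d N (Suc n) F A y"
      using unit_steps_nonempty[OF d]
      by (simp add: integral_pmf_of_set step_avg_def card_unit_steps)
    finally show ?case .
  }
qed

lemma prob_space_srw_space: "prob_space (srw_space d N)"
proof -
  interpret S: prob_space "step_space d" by (rule prob_space_PiM) unfold_locales
  interpret P: pair_prob_space "measure_pmf (pmf_of_set (torus d N))" "step_space d" ..
  show ?thesis unfolding srw_space_def by unfold_locales
qed

text \<open>Insensitivity of F to points off the torus transfers measurability from the range cut
  down to the torus to the range itself.\<close>

lemma integral_range:
  fixes F :: "(nat \<Rightarrow> int) set \<Rightarrow> real"
  assumes d: "0 < d" and N: "0 < N"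
    and F: "\<And>A. \<bar>F A\<bar> \<le> b" "\<And>A. F (A \<inter> torus d N) = F A"
  shows "integrable (srw_space d N) (\<lambda>\<omega>. F ((\<lambda>k. walk d N k \<omega>) ` {..n}))"
    and "(\<integral>\<omega>. F ((\<lambda>k. walk d N k \<omega>) ` {..n}) \<partial>srw_space d N)
      = (\<Sum>y\<in>torus d N. range_mean d N n F {} y) / real N ^ d"
proof -
  interpret S: prob_space "step_space d" by (rule prob_space_PiM) unfold_locales
  let ?M = "measure_pmf (pmf_of_set (torus d N))"
  interpret P: pair_prob_space ?M "step_space d" ..
  interpret R: prob_space "srw_space d N" by (rule prob_space_srw_space)
  have ne: "torus d N \<noteq> {}" using card_torus[of d N] N by auto
  show int: "integrable (srw_space d N) (\<lambda>\<omega>. F ((\<lambda>k. walk d N k \<omega>) ` {..n}))"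
    using borel_measurable_range[OF N, of F d n] F(1)
    by (intro R.integrable_const_bound[of _ b]) (simp_all add: F(2))
  have "(\<integral>\<omega>. F ((\<lambda>k. walk d N k \<omega>) ` {..n}) \<partial>srw_space d N)
      = (\<integral>y. \<integral>s. F ((\<lambda>k. walk d N k (y, s)) ` {..n}) \<partial>step_space d \<partial>?M)"
    using P.integral_fst'[OF int[unfolded srw_space_def]] by (simp add: srw_space_def)
  also have "\<dots> = (\<Sum>y\<in>torus d N. \<integral>s. F ({} \<union> (\<lambda>k. walk d N k (y, s)) ` {..n}) \<partial>step_space d) / real N ^ d"
    using ne by (simp add: integral_pmf_of_set card_torus)
  also have "\<dots> = (\<Sum>y\<in>torus d N. range_mean d N n F {} y) / real N ^ d"
    by (simp only: integral_range_from[where F = F and b = b, OF d N F(1)] cong: sum.cong)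
  finally show "(\<integral>\<omega>. F ((\<lambda>k. walk d N k \<omega>) ` {..n}) \<partial>srw_space d N)
      = (\<Sum>y\<in>torus d N. range_mean d N n F {} y) / real N ^ d" .
qed

section \<open>Concentration of the spatial average\<close>

lemma walk_range_eq:
  assumes "0 \<le> t" shows "walk_range d N t \<omega> = (\<lambda>k. walk d N k \<omega>) ` {..nat \<lfloor>t\<rfloor>}"
proof -
  have "real n \<le> t \<longleftrightarrow> n \<le> nat \<lfloor>t\<rfloor>" for n
    using assms by (simp add: le_nat_iff le_floor_iff)
  then show ?thesis by (auto simp: walk_range_def)
qed

lemma Gamma_avg_Chebyshev:
  assumes d: "3 \<le> d" and L: "1 \<le> L" "L \<le> N" and u: "0 < u" and s: "0 < s"
    and \<phi>: "\<phi> \<in> Pow (torus_ball d N (torus_zero d) L) \<rightarrow> {0..1}"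
  shows "integrable (srw_space d N) (Gamma_avg d N L \<phi> u)"
    and "\<P>(\<omega> in srw_space d N.
        s \<le> \<bar>Gamma_avg d N L \<phi> u \<omega> - (\<integral>\<omega>'. Gamma_avg d N L \<phi> u \<omega>' \<partial>srw_space d N)\<bar>)
      \<le> (2 * real (4 * d + 9) ^ d + 2 * (2 * (5 * real d) ^ d * (2 * real d + 3))\<^sup>2)
        * ((real L / real N) ^ d + u * (real L ^ d / real N)) / s\<^sup>2"
proof -
  have d0: "0 < d" and N: "0 < N" using d L by auto
  interpret R: prob_space "srw_space d N" by (rule prob_space_srw_space)
  define n where "n = nat \<lfloor>u * real N ^ d\<rfloor>"
  have n: "real n \<le> u * real N ^ d" using u by (simp add: n_def)
  let ?V = "(2 * real (4 * d + 9) ^ d + 2 * (2 * (5 * real d) ^ d * (2 * real d + 3))\<^sup>2)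
        * ((real L / real N) ^ d + u * (real L ^ d / real N))"
  let ?G = "trace_avg d N L \<phi>" and ?\<Gamma> = "Gamma_avg d N L \<phi> u"
  have \<Gamma>: "?\<Gamma> = (\<lambda>\<omega>. ?G ((\<lambda>k. walk d N k \<omega>) ` {..n}))"
    using u by (auto simp: Gamma_avg_eq walk_range_eq n_def)
  note G = trace_avg_bounds[OF d0 N \<phi>]
  have G1: "\<bar>?G A\<bar> \<le> 1" and G2: "\<bar>(?G A)\<^sup>2\<bar> \<le> 1" for A
    using G[of A] by (auto simp: power_le_one)
  note first = integral_range[OF d0 N, of ?G 1 n, OF G1 trace_avg_inter_torus]
  note second = integral_range[OF d0 N, of "\<lambda>A. (?G A)\<^sup>2" 1 n, OF G2 arg_cong[OF trace_avg_inter_torus]]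
  show int: "integrable (srw_space d N) ?\<Gamma>" unfolding \<Gamma> by (rule first(1))
  have int2: "integrable (srw_space d N) (\<lambda>\<omega>. (?\<Gamma> \<omega>)\<^sup>2)" unfolding \<Gamma> by (rule second(1))
  obtain y0 where y0: "y0 \<in> torus d N" using torus_proj_in_torus[OF N] by blast
  define m where "m = range_mean d N n ?G {} y0"
  have m: "range_mean d N n ?G {} y = m" if "y \<in> torus d N" for y
    unfolding m_def by (rule range_mean_trace_avg_const[OF N that y0])
  \<comment> \<open>All conditional means given the start equal m, so the variance is the plain
    average over the starts of the conditional variances.\<close>
  have "R.expectation ?\<Gamma> = m"
    unfolding \<Gamma> first(2) using m N by (simp add: card_torus)
  then have "R.variance ?\<Gamma> = (\<Sum>y\<in>torus d N. range_mean d N n (\<lambda>A. (?G A)\<^sup>2) {} y) / real N ^ d - m\<^sup>2"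
    using R.variance_eq[OF int int2] second(2) by (simp add: \<Gamma>)
  also have "\<dots> = (\<Sum>y\<in>torus d N. range_var d N n ?G {} y) / real N ^ d"
    using m N by (simp add: range_var_def sum_subtractf card_torus diff_divide_distrib)
  also have "\<dots> \<le> (\<Sum>y\<in>torus d N. ?V) / real N ^ d"
    by (intro divide_right_mono sum_mono range_var_trace_avg_le d L \<phi> n) auto
  also have "\<dots> = ?V" using N by (simp add: card_torus)
  finally have var: "R.variance ?\<Gamma> \<le> ?V" .
  have "\<P>(\<omega> in srw_space d N. s \<le> \<bar>?\<Gamma> \<omega> - R.expectation ?\<Gamma>\<bar>) \<le> R.variance ?\<Gamma> / s\<^sup>2"
    using int by (intro R.Chebyshev_inequality int2 s) simp
  also have "\<dots> \<le> ?V / s\<^sup>2" using var by (intro divide_right_mono) auto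
  finally show "\<P>(\<omega> in srw_space d N. s \<le> \<bar>?\<Gamma> \<omega> - R.expectation ?\<Gamma>\<bar>) \<le> ?V / s\<^sup>2" .
qed

text \<open>Every admissible r satisfies L \<le> r \<le> N, so the comparison holds term by term,
  with L replacing r in the first term and N replacing r in the second.\<close>

lemma sigma_sq_ge:
  assumes "1 \<le> L" "100 * L \<le> N" "0 \<le> u"
  shows "(real L / real N) ^ d + u * (real L ^ d / real N) \<le> sigma_sq d u L N"
  unfolding sigma_sq_def
proof (rule cInf_greatest)
  \<comment> \<open>The infimum is over a nonempty set: r = 10 L is admissible because 100 L \<le>
    N.\<close>
  have "10 * L \<le> 10 * L \<and> real (10 * L) \<le> real N / 10" using assms(2) by simp
  then show "{(real r / real N) ^ d + u * (real L ^ d / real r) | r :: nat.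
      10 * L \<le> r \<and> real r \<le> real N / 10} \<noteq> {}"
    by blast
next
  fix z assume "z \<in> {(real r / real N) ^ d + u * (real L ^ d / real r) | r :: nat.
      10 * L \<le> r \<and> real r \<le> real N / 10}"
  then obtain r :: nat where r: "10 * L \<le> r" "real r \<le> real N / 10"
    and z: "z = (real r / real N) ^ d + u * (real L ^ d / real r)"
    by blast
  show "(real L / real N) ^ d + u * (real L ^ d / real N) \<le> z"
    unfolding z using r assms
    by (intro add_mono power_mono divide_right_mono mult_left_mono divide_left_mono) auto
qed

theorem theorem4p3:
  fixes d :: nat and c8 c9 c11 :: real
  assumes "3 \<le> d"
    and "excursion_constants d c8 c9"
    and "c11 = c8 / c9"
  shows "\<exists>a1>0. \<exists>a2>0. \<exists>a3>0. \<exists>a4>0. \<exists>a5>0.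
         \<exists>b1>0. \<exists>b2>0. \<exists>b3>0. \<exists>b4>0. \<exists>b5>0.
    \<forall>(L::nat) (N::nat) (\<phi> :: (nat \<Rightarrow> int) set \<Rightarrow> real) (u::real) (s::real).
      1 \<le> L \<longrightarrow> 100 * L \<le> N \<longrightarrow>
      \<phi> \<in> Pow (torus_ball d N (torus_zero d) L) \<rightarrow> {0..1} \<longrightarrow>
      antimono_on (Pow (torus_ball d N (torus_zero d) L)) \<phi> \<longrightarrow>
      0 < u \<longrightarrow> 0 < s \<longrightarrow>
      \<P>(\<omega> in srw_space d N.
          Gamma_avg d N L \<phi> u \<omega>
            < (\<integral>\<omega>'. Gamma_avg d N L \<phi> (c11 * u) \<omega>' \<partial>srw_space d N)
              - a1 * exp (- (a2 * u * real L ^ (d - 2))) - s)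
        \<le> a3 * (sigma_sq d u L N / s\<^sup>2)
          + a4 * real N ^ d * exp (- (a5 * u * real L ^ (d - 2))) \<and>
      \<P>(\<omega> in srw_space d N.
          Gamma_avg d N L \<phi> u \<omega>
            > (\<integral>\<omega>'. Gamma_avg d N L \<phi> (inverse c11 * u) \<omega>' \<partial>srw_space d N)
              + b1 * exp (- (b2 * u * real L ^ (d - 2))) + s)
        \<le> b3 * (sigma_sq d u L N / s\<^sup>2)
          + b4 * real N ^ d * exp (- (b5 * u * real L ^ (d - 2)))"
proof -
  define C where "C = 2 * real (4 * d + 9) ^ d + 2 * (2 * (5 * real d) ^ d * (2 * real d + 3))\<^sup>2"
  have d0: "0 < d" using assms(1) by simp
  have C: "0 < C" unfolding C_def by (intro add_pos_nonneg) auto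
  have c11: "1 < c11" "0 < c11"
    using assms(2,3) by (auto simp: excursion_constants_def)
  \<comment> \<open>The exponential terms enter through their nonnegativity, so all their constants
    are taken to be 1; \<open>C\<close> is the constant of the variance bound.\<close>
  have main: "\<P>(\<omega> in srw_space d N. Gamma_avg d N L \<phi> u \<omega>
          < (\<integral>\<omega>'. Gamma_avg d N L \<phi> (c11 * u) \<omega>' \<partial>srw_space d N)
            - 1 * exp (- (1 * u * real L ^ (d - 2))) - s)
      \<le> C * (sigma_sq d u L N / s\<^sup>2) + 1 * real N ^ d * exp (- (1 * u * real L ^ (d - 2))) \<and>
    \<P>(\<omega> in srw_space d N. Gamma_avg d N L \<phi> u \<omega>
          > (\<integral>\<omega>'. Gamma_avg d N L \<phi> (inverse c11 * u) \<omega>' \<partial>srw_space d N)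
            + 1 * exp (- (1 * u * real L ^ (d - 2))) + s)
      \<le> C * (sigma_sq d u L N / s\<^sup>2) + 1 * real N ^ d * exp (- (1 * u * real L ^ (d - 2)))"
    if L: "1 \<le> L" "100 * L \<le> N" and \<phi>: "\<phi> \<in> Pow (torus_ball d N (torus_zero d) L) \<rightarrow> {0..1}"
      and anti: "antimono_on (Pow (torus_ball d N (torus_zero d) L)) \<phi>" and u: "0 < u" and s: "0 < s"
    for L N :: nat and \<phi> :: "(nat \<Rightarrow> int) set \<Rightarrow> real" and u s :: real
  proof -
    interpret R: prob_space "srw_space d N" by (rule prob_space_srw_space)
    have LN: "L \<le> N" and N: "0 < N" using L by auto
    let ?E = "\<lambda>v. \<integral>\<omega>'. Gamma_avg d N L \<phi> v \<omega>' \<partial>srw_space d N"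
    let ?\<Gamma> = "Gamma_avg d N L \<phi> u" and ?e = "exp (- (1 * u * real L ^ (d - 2)))"
    let ?B = "{\<omega> \<in> space (srw_space d N). s \<le> \<bar>?\<Gamma> \<omega> - ?E u\<bar>}"
    note cheb = Gamma_avg_Chebyshev[OF assms(1) L(1) LN _ s \<phi>]
    have E_mono: "?E w \<le> ?E v" if "0 < v" "v \<le> w" for v w
    proof (rule integral_mono)
      show "integrable (srw_space d N) (Gamma_avg d N L \<phi> v)" "integrable (srw_space d N) (Gamma_avg d N L \<phi> w)"
        using cheb(1) that by auto
      show "Gamma_avg d N L \<phi> w \<omega> \<le> Gamma_avg d N L \<phi> v \<omega>" for \<omega>
      proof -
        have "v * real N ^ d \<le> w * real N ^ d" using that(2) by (simp add: mult_right_mono)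
        then have "walk_range d N (v * real N ^ d) \<omega> \<subseteq> walk_range d N (w * real N ^ d) \<omega>"
          by (force simp: walk_range_def)
        then show ?thesis unfolding Gamma_avg_eq by (rule trace_avg_antimono[OF d0 N anti])
      qed
    qed
    have "R.prob ?B \<le> C * ((real L / real N) ^ d + u * (real L ^ d / real N)) / s\<^sup>2"
      using cheb(2)[OF u] by (simp add: C_def)
    also have "\<dots> \<le> C * sigma_sq d u L N / s\<^sup>2"
      using C by (intro divide_right_mono mult_left_mono sigma_sq_ge L) (use u in auto)
    also have "\<dots> \<le> C * (sigma_sq d u L N / s\<^sup>2) + 1 * real N ^ d * ?e" by simp
    finally have B: "R.prob ?B \<le> C * (sigma_sq d u L N / s\<^sup>2) + 1 * real N ^ d * ?e" .
    \<comment> \<open>Both one-sided events turn out to be subsets of \<open>?B\<close>, and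
      comparing probabilities asks for measurability of the larger event \<open>?B\<close>
      alone.\<close>
    have "?\<Gamma> \<in> borel_measurable (srw_space d N)" using cheb(1)[OF u] by simp
    then have "?B \<in> sets (srw_space d N)" by measurable
    then have le: "R.prob A \<le> C * (sigma_sq d u L N / s\<^sup>2) + 1 * real N ^ d * ?e" if "A \<subseteq> ?B" for A
      using R.finite_measure_mono[OF that] B by simp
    have "u \<le> c11 * u" "0 < inverse c11 * u" "inverse c11 * u \<le> u"
      using c11 u by (auto simp: field_simps)
    then have "?E (c11 * u) \<le> ?E u" "?E u \<le> ?E (inverse c11 * u)"
      using u by (auto intro: E_mono)
    moreover define \<epsilon> where "\<epsilon> = ?e"
    moreover have "0 \<le> \<epsilon>" by (simp add: \<epsilon>_def)
    ultimately show ?thesis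
      using s unfolding \<epsilon>_def[symmetric] by (intro conjI le[folded \<epsilon>_def] subsetI) auto
  qed
  show ?thesis
    by (rule exI[of _ 1], rule conjI[OF zero_less_one], rule exI[of _ 1], rule conjI[OF zero_less_one],
        rule exI[of _ C], rule conjI[OF C], rule exI[of _ 1], rule conjI[OF zero_less_one],
        rule exI[of _ 1], rule conjI[OF zero_less_one], rule exI[of _ 1], rule conjI[OF zero_less_one],
        rule exI[of _ 1], rule conjI[OF zero_less_one], rule exI[of _ C], rule conjI[OF C],
        rule exI[of _ 1], rule conjI[OF zero_less_one], rule exI[of _ 1], rule conjI[OF zero_less_one],
        intro allI impI, rule main)
qed

end
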